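(* Let $\mathsf{Gpd}$ be the category of small groupoids and functors and $\mathcal{G}$ the class of normal cloven (Grothendieck) fibrations. The pair $(\mathsf{Gpd}, \mathcal{G})$ is a tribe with stable path objects.
   Context: A functor $p\colon E\to X$ is a Grothendieck fibration if every arrow of $X$ with domain $p(e)$ has a lifting along $p$ (an arrow of $E$ with domain $e$ mapped to it). A cloven fibration is a Grothendieck fibration with a choice of such liftings that is stable under pullback and composition; it is normal if the chosen lifting of an identity is an identity. An arrow $f$ has the left lifting property with respect to $g$ if every commutative square with $f$ on the left and $g$ on the right has a diagonal filler. A tribe is a pair $(\mathsf{C},\mathcal{A})$ where $\mathsf{C}$ has a terminal object and: (a) for every pair of arrows with common codomain, at least one in $\mathcal{A}$, there is a chosen pullback; (b) $\mathcal{A}$ is closed under composition and base change; (c) all isomorphisms and terminal arrows are in $\mathcal{A}$. It has path objects if for every $p\colon E\to Y$ in $\mathcal{A}$ there is a chosen factorization of the diagonal $E\to E\times_pE$ as $\mathrm{r}_p\colon E\to\mathrm{Path}(p)$ followed by $\partial_p=\langle\partial^0_p,\partial^1_p\rangle\colon\mathrm{Path}(p)\to E\times_pE$ with $\partial_p\in\mathcal{A}$ and every base change of $\mathrm{r}_p$ along an arrow of $\mathcal{A}$ having the left lifting property with respect to all arrows of $\mathcal{A}$. For $g\colon X\to E$, $\mathrm{Map}_p(g)$ is the pullback of $g$ along $\partial^0_p$ with projections $\mathrm{pm}_0,\mathrm{pm}_1$. Stable path objects: for every $p\colon E\to Y$ in $\mathcal{A}$ and $f\colon X\to Y$, with $F$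 the pullback of $f$ and $p$ and base changes $f^*p\colon F\to X$, $p^*f\colon F\to E$, there is $i\colon\mathrm{Map}_p(p^*f)\to\mathrm{Path}(f^*p)$ with $i\circ\langle\mathrm{id}_F,\mathrm{r}_p\,p^*f\rangle=\mathrm{r}_{f^*p}$ and $\partial_{f^*p}\circ i=\langle\mathrm{pm}_0,\langle(f^*p)\mathrm{pm}_0,\partial^1_p\mathrm{pm}_1\rangle\rangle$. *)

theory Defs
  imports Main "HOL-Library.FuncSet"
begin

unbundle cardinal_syntax

section \<open>Categories\<close>

record ('o, 'a) cat =
  obj :: "'o set"
  arr :: "'a set"
  src :: "'a \<Rightarrow> 'o"
  tgt :: "'a \<Rightarrow> 'o"
  ident :: "'o \<Rightarrow> 'a"
  cmp :: "'a \<Rightarrow> 'a \<Rightarrow> 'a"  (infixr "\<cdot>\<index>" 70)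

locale category =
  fixes C :: "('o, 'a) cat" (structure)
  assumes src_closed: "f \<in> arr C \<Longrightarrow> src C f \<in> obj C"
    and tgt_closed: "f \<in> arr C \<Longrightarrow> tgt C f \<in> obj C"
    and ident_closed: "X \<in> obj C \<Longrightarrow> ident C X \<in> arr C"
    and src_ident: "X \<in> obj C \<Longrightarrow> src C (ident C X) = X"
    and tgt_ident: "X \<in> obj C \<Longrightarrow> tgt C (ident C X) = X"
    and cmp_closed: "\<lbrakk>f \<in> arr C; g \<in> arr C; tgt C f = src C g\<rbrakk> \<Longrightarrow> g \<cdot> f \<in> arr C"
    and src_cmp: "\<lbrakk>f \<in> arr C; g \<in> arr C; tgt C f = src C g\<rbrakk> \<Longrightarrow> src C (g \<cdot> f) = src C f"
    and tgt_cmp: "\<lbrakk>f \<in> arr C; g \<in> arr C; tgt C f = src C g\<rbrakk> \<Longrightarrow> tgt C (g \<cdot> f) = tgt C g"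
    and cmp_ident: "f \<in> arr C \<Longrightarrow> f \<cdot> ident C (src C f) = f"
    and ident_cmp: "f \<in> arr C \<Longrightarrow> ident C (tgt C f) \<cdot> f = f"
    and cmp_assoc: "\<lbrakk>f \<in> arr C; g \<in> arr C; h \<in> arr C; tgt C f = src C g; tgt C g = src C h\<rbrakk>
      \<Longrightarrow> (h \<cdot> g) \<cdot> f = h \<cdot> g \<cdot> f"

definition hom :: "('o, 'a) cat \<Rightarrow> 'o \<Rightarrow> 'o \<Rightarrow> 'a set" where
  "hom C X Y = {f \<in> arr C. src C f = X \<and> tgt C f = Y}"

definition isomorphism :: "('o, 'a) cat \<Rightarrow> 'a \<Rightarrow> bool" where
  "isomorphism C f \<longleftrightarrow> f \<in> arr C \<and>
     (\<exists>g \<in> hom C (tgt C f) (src C f).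
        g \<cdot>\<^bsub>C\<^esub> f = ident C (src C f) \<and> f \<cdot>\<^bsub>C\<^esub> g = ident C (tgt C f))"

definition terminal :: "('o, 'a) cat \<Rightarrow> 'o \<Rightarrow> bool" where
  "terminal C T \<longleftrightarrow> T \<in> obj C \<and> (\<forall>X \<in> obj C. \<exists>!h. h \<in> hom C X T)"

text \<open>In \<open>is_pullback C f g p q\<close> the arrow \<open>p\<close> is opposite to \<open>g\<close>, that is, \<open>p\<close> is a base change
  of \<open>g\<close> along \<open>f\<close>, and \<open>q\<close> is a base change of \<open>f\<close> along \<open>g\<close>.\<close>

definition is_pullback :: "('o, 'a) cat \<Rightarrow> 'a \<Rightarrow> 'a \<Rightarrow> 'a \<Rightarrow> 'a \<Rightarrow> bool" where
  "is_pullback C f g p q \<longleftrightarrow>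
     f \<in> arr C \<and> g \<in> arr C \<and> tgt C f = tgt C g \<and>
     p \<in> arr C \<and> q \<in> arr C \<and> src C p = src C q \<and> tgt C p = src C f \<and> tgt C q = src C g \<and>
     f \<cdot>\<^bsub>C\<^esub> p = g \<cdot>\<^bsub>C\<^esub> q \<and>
     (\<forall>u \<in> arr C. \<forall>v \<in> arr C.
        src C u = src C v \<and> tgt C u = src C f \<and> tgt C v = src C g \<and> f \<cdot>\<^bsub>C\<^esub> u = g \<cdot>\<^bsub>C\<^esub> v \<longrightarrow>
        (\<exists>!h. h \<in> hom C (src C u) (src C p) \<and> p \<cdot>\<^bsub>C\<^esub> h = u \<and> q \<cdot>\<^bsub>C\<^esub> h = v))"

definition left_lifting :: "('o, 'a) cat \<Rightarrow> 'a \<Rightarrow> 'a \<Rightarrow> bool" where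
  "left_lifting C f g \<longleftrightarrow>
     (\<forall>u \<in> hom C (src C f) (src C g). \<forall>v \<in> hom C (tgt C f) (tgt C g).
        g \<cdot>\<^bsub>C\<^esub> u = v \<cdot>\<^bsub>C\<^esub> f \<longrightarrow>
        (\<exists>h \<in> hom C (tgt C f) (src C g). h \<cdot>\<^bsub>C\<^esub> f = u \<and> g \<cdot>\<^bsub>C\<^esub> h = v))"


section \<open>Tribes\<close>

text \<open>The chosen pullback of \<open>f\<close> and \<open>g\<close> is given by its pair of projections \<open>pb f g\<close>, the first
  being the base change of \<open>g\<close> along \<open>f\<close>. The value of \<open>pb\<close> matters only when one of the two
  arrows is in \<open>\<A>\<close>.\<close>

locale tribe = category C
  for C :: "('o, 'a) cat" (structure) +
  fixes \<A> :: "'a set"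
    and pb :: "'a \<Rightarrow> 'a \<Rightarrow> 'a \<times> 'a"
  assumes class_arr: "\<A> \<subseteq> arr C"
    and has_terminal: "\<exists>T. terminal C T"
    and chosen_pullback:
      "\<lbrakk>f \<in> arr C; g \<in> arr C; tgt C f = tgt C g; f \<in> \<A> \<or> g \<in> \<A>\<rbrakk>
        \<Longrightarrow> is_pullback C f g (fst (pb f g)) (snd (pb f g))"
    and class_cmp: "\<lbrakk>f \<in> \<A>; g \<in> \<A>; tgt C f = src C g\<rbrakk> \<Longrightarrow> g \<cdot> f \<in> \<A>"
    and class_base_change: "\<lbrakk>is_pullback C f g p q; g \<in> \<A>\<rbrakk> \<Longrightarrow> p \<in> \<A>"
    and class_isomorphism: "isomorphism C f \<Longrightarrow> f \<in> \<A>"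
    and class_terminal: "\<lbrakk>f \<in> arr C; terminal C (tgt C f)\<rbrakk> \<Longrightarrow> f \<in> \<A>"
begin

definition pr0 :: "'a \<Rightarrow> 'a \<Rightarrow> 'a" where "pr0 f g = fst (pb f g)"

definition pr1 :: "'a \<Rightarrow> 'a \<Rightarrow> 'a" where "pr1 f g = snd (pb f g)"

definition apex :: "'a \<Rightarrow> 'a \<Rightarrow> 'o" where "apex f g = src C (pr0 f g)"

text \<open>The arrow \<open>\<langle>u, v\<rangle>\<close> into the chosen pullback of \<open>f\<close> and \<open>g\<close>.\<close>

definition pairing :: "'a \<Rightarrow> 'a \<Rightarrow> 'a \<Rightarrow> 'a \<Rightarrow> 'a" where
  "pairing f g u v =
     (THE h. h \<in> hom C (src C u) (apex f g) \<and> pr0 f g \<cdot> h = u \<and> pr1 f g \<cdot> h = v)"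

definition diagonal :: "'a \<Rightarrow> 'a" where
  "diagonal p = pairing p p (ident C (src C p)) (ident C (src C p))"

end

locale tribe_with_path_objects = tribe C \<A> pb
  for C :: "('o, 'a) cat" (structure)
    and \<A> :: "'a set"
    and pb :: "'a \<Rightarrow> 'a \<Rightarrow> 'a \<times> 'a" +
  fixes r :: "'a \<Rightarrow> 'a"
    and bd :: "'a \<Rightarrow> 'a"  ("\<partial>")
  assumes r_arr: "p \<in> \<A> \<Longrightarrow> r p \<in> hom C (src C p) (src C (\<partial> p))"
    and bd_class: "p \<in> \<A> \<Longrightarrow> \<partial> p \<in> \<A>"
    and bd_tgt: "p \<in> \<A> \<Longrightarrow> tgt C (\<partial> p) = apex p p"
    and bd_r: "p \<in> \<A> \<Longrightarrow> \<partial> p \<cdot> r p = diagonal p"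
    and base_change_r_left_lifting:
      "\<lbrakk>p \<in> \<A>; q \<in> \<A>; is_pullback C q (r p) s t; g \<in> \<A>\<rbrakk> \<Longrightarrow> left_lifting C s g"
begin

definition Path :: "'a \<Rightarrow> 'o" where "Path p = src C (\<partial> p)"

definition bd0 :: "'a \<Rightarrow> 'a"  ("\<partial>\<^sup>0") where "\<partial>\<^sup>0 p = pr0 p p \<cdot> \<partial> p"

definition bd1 :: "'a \<Rightarrow> 'a"  ("\<partial>\<^sup>1") where "\<partial>\<^sup>1 p = pr1 p p \<cdot> \<partial> p"

definition Map :: "'a \<Rightarrow> 'a \<Rightarrow> 'o" where "Map p g = apex g (\<partial>\<^sup>0 p)"

definition pm0 :: "'a \<Rightarrow> 'a \<Rightarrow> 'a" where "pm0 p g = pr0 g (\<partial>\<^sup>0 p)"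

definition pm1 :: "'a \<Rightarrow> 'a \<Rightarrow> 'a" where "pm1 p g = pr1 g (\<partial>\<^sup>0 p)"

end

text \<open>Below, \<open>fp\<close> is the base change of \<open>p\<close> along \<open>f\<close>, and \<open>pf\<close> that of \<open>f\<close> along \<open>p\<close>.\<close>

locale tribe_with_stable_path_objects = tribe_with_path_objects C \<A> pb r bd
  for C :: "('o, 'a) cat" (structure)
    and \<A> :: "'a set"
    and pb :: "'a \<Rightarrow> 'a \<Rightarrow> 'a \<times> 'a"
    and r :: "'a \<Rightarrow> 'a"
    and bd :: "'a \<Rightarrow> 'a"  ("\<partial>") +
  assumes stable_path_objects:
    "\<lbrakk>p \<in> \<A>; f \<in> arr C; tgt C f = tgt C p; fp = pr0 f p; pf = pr1 f p\<rbrakk> \<Longrightarrow>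
      \<exists>i \<in> hom C (Map p pf) (Path fp).
        i \<cdot> pairing pf (\<partial>\<^sup>0 p) (ident C (apex f p)) (r p \<cdot> pf) = r fp \<and>
        \<partial> fp \<cdot> i =
          pairing fp fp (pm0 p pf) (pairing f p (fp \<cdot> pm0 p pf) (\<partial>\<^sup>1 p \<cdot> pm1 p pf))"


section \<open>Functors\<close>

text \<open>Functors carry their domain and codomain, and are extensional (\<open>undefined\<close> outside the
  domain), so that equality of records is equality of functors.\<close>

record ('o, 'a) ftor =
  fdom :: "('o, 'a) cat"
  fcod :: "('o, 'a) cat"
  fob :: "'o \<Rightarrow> 'o"
  far :: "'a \<Rightarrow> 'a"

locale is_functor =
  fixes F :: "('o, 'a) ftor"
  assumes fdom_category: "category (fdom F)"
    and fcod_category: "category (fcod F)"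
    and fob_closed: "fob F \<in> obj (fdom F) \<rightarrow>\<^sub>E obj (fcod F)"
    and far_closed: "far F \<in> arr (fdom F) \<rightarrow>\<^sub>E arr (fcod F)"
    and far_src: "f \<in> arr (fdom F) \<Longrightarrow> src (fcod F) (far F f) = fob F (src (fdom F) f)"
    and far_tgt: "f \<in> arr (fdom F) \<Longrightarrow> tgt (fcod F) (far F f) = fob F (tgt (fdom F) f)"
    and far_ident: "X \<in> obj (fdom F) \<Longrightarrow> far F (ident (fdom F) X) = ident (fcod F) (fob F X)"
    and far_cmp: "\<lbrakk>f \<in> arr (fdom F); g \<in> arr (fdom F); tgt (fdom F) f = src (fdom F) g\<rbrakk>
      \<Longrightarrow> far F (g \<cdot>\<^bsub>fdom F\<^esub> f) = far F g \<cdot>\<^bsub>fcod F\<^esub> far F f"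

definition id_functor :: "('o, 'a) cat \<Rightarrow> ('o, 'a) ftor" where
  "id_functor A = \<lparr>fdom = A, fcod = A, fob = (\<lambda>x \<in> obj A. x), far = (\<lambda>f \<in> arr A. f)\<rparr>"

definition comp_functor :: "('o, 'a) ftor \<Rightarrow> ('o, 'a) ftor \<Rightarrow> ('o, 'a) ftor" where
  "comp_functor G F =
     \<lparr>fdom = fdom F, fcod = fcod G,
      fob = compose (obj (fdom F)) (fob G) (fob F),
      far = compose (arr (fdom F)) (far G) (far F)\<rparr>"


section \<open>The category of small groupoids\<close>

locale groupoid = category +
  assumes all_isomorphisms: "f \<in> arr C \<Longrightarrow> isomorphism C f"

text \<open>A set is small if its cardinality is below the infinite cardinal \<open>\<kappa>\<close>. As \<open>\<kappa>\<close> is a cardinal on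
  the type \<open>'u\<close>, every set of cardinality below \<open>\<kappa>\<close> is in bijection with a subset of \<open>'u\<close>, so that
  every groupoid of size below \<open>\<kappa>\<close> is isomorphic to one with objects and arrows in \<open>'u\<close>. A
  Grothendieck universe is the case of an inaccessible \<open>\<kappa>\<close>. The last four conditions fix the
  irrelevant values of the operations, so that equality of records is equality of groupoids.\<close>

definition small_groupoid :: "'u rel \<Rightarrow> ('u, 'u) cat \<Rightarrow> bool" where
  "small_groupoid \<kappa> A \<longleftrightarrow>
     groupoid A \<and> |obj A| <o \<kappa> \<and> |arr A| <o \<kappa> \<and>
     src A \<in> extensional (arr A) \<and> tgt A \<in> extensional (arr A) \<and>
     ident A \<in> extensional (obj A) \<and>
     (\<forall>f g. \<not> (f \<in> arr A \<and> g \<in> arr A \<and> tgt A f = src A g) \<longrightarrow> g \<cdot>\<^bsub>A\<^esub> f = undefined)"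

definition Gpd :: "'u rel \<Rightarrow> (('u, 'u) cat, ('u, 'u) ftor) cat" where
  "Gpd \<kappa> =
     \<lparr>obj = {A. small_groupoid \<kappa> A},
      arr = {F. is_functor F \<and> small_groupoid \<kappa> (fdom F) \<and> small_groupoid \<kappa> (fcod F)},
      src = fdom, tgt = fcod, ident = id_functor, cmp = comp_functor\<rparr>"


section \<open>Normal cloven fibrations\<close>

definition is_lifting :: "('o, 'a) ftor \<Rightarrow> 'o \<Rightarrow> 'a \<Rightarrow> 'a \<Rightarrow> bool" where
  "is_lifting p e a b \<longleftrightarrow> b \<in> arr (fdom p) \<and> src (fdom p) b = e \<and> far p b = a"

definition Grothendieck_fibration :: "('o, 'a) ftor \<Rightarrow> bool" where
  "Grothendieck_fibration p \<longleftrightarrow> is_functor p \<and>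
     (\<forall>e \<in> obj (fdom p). \<forall>a \<in> arr (fcod p). src (fcod p) a = fob p e \<longrightarrow>
        (\<exists>b. is_lifting p e a b))"

text \<open>A choice of liftings \<open>l\<close> assigns to \<open>e\<close> and to an arrow \<open>a\<close> with domain \<open>p e\<close> the chosen
  lifting \<open>l e a\<close>; it is irrelevant on other arguments.\<close>

definition cleavage :: "('o, 'a) ftor \<Rightarrow> ('o \<Rightarrow> 'a \<Rightarrow> 'a) \<Rightarrow> bool" where
  "cleavage p l \<longleftrightarrow>
     (\<forall>e \<in> obj (fdom p). \<forall>a \<in> arr (fcod p). src (fcod p) a = fob p e \<longrightarrow>
        is_lifting p e a (l e a))"

definition normal :: "('o, 'a) ftor \<Rightarrow> ('o \<Rightarrow> 'a \<Rightarrow> 'a) \<Rightarrow> bool" where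
  "normal p l \<longleftrightarrow> (\<forall>e \<in> obj (fdom p). l e (ident (fcod p) (fob p e)) = ident (fdom p) e)"

definition normal_cloven_fibrations :: "'u rel \<Rightarrow> ('u, 'u) ftor set" where
  "normal_cloven_fibrations \<kappa> =
     {p \<in> arr (Gpd \<kappa>). Grothendieck_fibration p \<and> (\<exists>l. cleavage p l \<and> normal p l)}"

text \<open>Choices of liftings are stable under composition and pullback, for any cleavages: the
  composite of cloven fibrations and the base change of a cloven fibration carry an induced choice,
  normal if the given ones are. The two lemmas make this explicit; for the second, \<open>q\<close> and \<open>g\<close> form
  a strict pullback of \<open>f\<close> and \<open>p\<close>.\<close>

definition comp_cleavage ::
  "('o, 'a) ftor \<Rightarrow> ('o \<Rightarrow> 'a \<Rightarrow> 'a) \<Rightarrow> ('o \<Rightarrow> 'a \<Rightarrow> 'a) \<Rightarrow> 'o \<Rightarrow> 'a \<Rightarrow> 'a" where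
  "comp_cleavage p l m e a = l e (m (fob p e) a)"

lemma comp_cleavage:
  assumes "is_functor p" "is_functor q" "fcod p = fdom q" "cleavage p l" "cleavage q m"
  shows "cleavage (comp_functor q p) (comp_cleavage p l m)"
    and "\<lbrakk>normal p l; normal q m\<rbrakk> \<Longrightarrow> normal (comp_functor q p) (comp_cleavage p l m)"
proof -
  interpret p: is_functor p by fact
  interpret q: is_functor q by fact
  have ob: "fob p e \<in> obj (fdom q)" if "e \<in> obj (fdom p)" for e
    using p.fob_closed that assms(3) by (auto simp: PiE_iff)
  show "cleavage (comp_functor q p) (comp_cleavage p l m)"
    using assms(3,4,5) ob
    by (simp add: cleavage_def is_lifting_def comp_functor_def comp_cleavage_def compose_def)
  show "normal (comp_functor q p) (comp_cleavage p l m)" if "normal p l" "normal q m"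
    using assms(3) that ob
    by (simp add: normal_def comp_functor_def comp_cleavage_def compose_def)
qed

definition pullback_cleavage ::
  "('o, 'a) ftor \<Rightarrow> ('o, 'a) ftor \<Rightarrow> ('o, 'a) ftor \<Rightarrow> ('o \<Rightarrow> 'a \<Rightarrow> 'a) \<Rightarrow> 'o \<Rightarrow> 'a \<Rightarrow> 'a" where
  "pullback_cleavage f q g l z a =
     (THE b. is_lifting q z a b \<and> far g b = l (fob g z) (far f a))"

lemma pullback_cleavage:
  assumes "is_functor f" "is_functor p" "is_functor q" "is_functor g"
    and "fcod f = fcod p" "fdom q = fdom g" "fcod q = fdom f" "fcod g = fdom p"
    and "\<And>z. z \<in> obj (fdom q) \<Longrightarrow> fob f (fob q z) = fob p (fob g z)"
    and strict_ob: "bij_betw (\<lambda>z. (fob q z, fob g z)) (obj (fdom q))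
          {(x, e). x \<in> obj (fdom f) \<and> e \<in> obj (fdom p) \<and> fob f x = fob p e}"
    and strict_ar: "bij_betw (\<lambda>b. (far q b, far g b)) (arr (fdom q))
          {(a, b). a \<in> arr (fdom f) \<and> b \<in> arr (fdom p) \<and> far f a = far p b}"
    and l: "cleavage p l"
  shows "cleavage q (pullback_cleavage f q g l)"
    and "\<lbrakk>z \<in> obj (fdom q); a \<in> arr (fcod q); src (fcod q) a = fob q z\<rbrakk>
      \<Longrightarrow> far g (pullback_cleavage f q g l z a) = l (fob g z) (far f a)"
    and "normal p l \<Longrightarrow> normal q (pullback_cleavage f q g l)"
proof -
  interpret f: is_functor f by fact
  interpret q: is_functor q by fact
  interpret g: is_functor g by fact
  interpret Q: category "fdom q" by (rule q.fdom_category)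
  interpret X: category "fcod q" by (rule q.fcod_category)
  let ?l = "pullback_cleavage f q g l"
  have g_ob: "fob g z \<in> obj (fdom p)" if "z \<in> obj (fdom q)" for z
    using g.fob_closed that assms(6,8) by (auto simp: PiE_iff)
  have f_ar: "far f a \<in> arr (fcod p)" if "a \<in> arr (fcod q)" for a
    using f.far_closed that assms(5,7) by (auto simp: PiE_iff)
  have unique: "b = c" if "b \<in> arr (fdom q)" "c \<in> arr (fdom q)" "far q b = far q c" "far g b = far g c"
    for b c
    by (rule inj_onD[OF bij_betw_imp_inj_on[OF strict_ar]]) (use that in simp_all)
  have key: "is_lifting q z a (?l z a) \<and> far g (?l z a) = l (fob g z) (far f a)"
    if z: "z \<in> obj (fdom q)" and a: "a \<in> arr (fcod q)" and za: "src (fcod q) a = fob q z" for z a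
  proof -
    have "src (fcod p) (far f a) = fob p (fob g z)"
      using f.far_src[of a] a za assms(5,7) assms(9)[OF z] by simp
    then have L: "is_lifting p (fob g z) (far f a) (l (fob g z) (far f a))"
      using l g_ob[OF z] f_ar[OF a] by (simp add: cleavage_def)
    then have "(a, l (fob g z) (far f a)) \<in> (\<lambda>b. (far q b, far g b)) ` arr (fdom q)"
      using bij_betw_imp_surj_on[OF strict_ar] a assms(7) by (simp add: is_lifting_def)
    then obtain b where b: "b \<in> arr (fdom q)" "far q b = a" "far g b = l (fob g z) (far f a)"
      by auto
    have "fob q (src (fdom q) b) = fob q z"
      using q.far_src[OF b(1)] b(2) za by simp
    moreover have "fob g (src (fdom q) b) = fob g z"
      using g.far_src[of b] b(1,3) L assms(6,8) by (simp add: is_lifting_def)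
    ultimately have "src (fdom q) b = z"
      by (intro inj_onD[OF bij_betw_imp_inj_on[OF strict_ob] _ Q.src_closed[OF b(1)] z]) simp
    then have "is_lifting q z a b \<and> far g b = l (fob g z) (far f a)"
      using b by (simp add: is_lifting_def)
    then show ?thesis
      unfolding pullback_cleavage_def
    proof (rule theI)
      show "c = b" if "is_lifting q z a c \<and> far g c = l (fob g z) (far f a)" for c
        by (rule unique) (use that b in \<open>simp_all add: is_lifting_def\<close>)
    qed
  qed
  show "cleavage q ?l"
    using key by (simp add: cleavage_def)
  show "far g (?l z a) = l (fob g z) (far f a)"
    if "z \<in> obj (fdom q)" "a \<in> arr (fcod q)" "src (fcod q) a = fob q z"
    using key[OF that] by simp
  show "normal q ?l" if n: "normal p l"
    unfolding normal_def
  proof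
    fix z assume z: "z \<in> obj (fdom q)"
    have qz: "fob q z \<in> obj (fcod q)"
      using q.fob_closed z by (auto simp: PiE_iff)
    have k: "is_lifting q z (ident (fcod q) (fob q z)) (?l z (ident (fcod q) (fob q z)))"
      "far g (?l z (ident (fcod q) (fob q z))) = l (fob g z) (far f (ident (fcod q) (fob q z)))"
      using key[OF z X.ident_closed[OF qz] X.src_ident[OF qz]] by auto
    have "far f (ident (fcod q) (fob q z)) = ident (fcod p) (fob p (fob g z))"
      using f.far_ident qz assms(5,7) assms(9)[OF z] by simp
    then have "far g (?l z (ident (fcod q) (fob q z))) = ident (fdom p) (fob g z)"
      using k(2) n g_ob[OF z] by (simp add: normal_def)
    also have "\<dots> = far g (ident (fdom q) z)"
      using g.far_ident[of z] z assms(6,8) by simp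
    finally have g: "far g (?l z (ident (fcod q) (fob q z))) = far g (ident (fdom q) z)" .
    have arr: "?l z (ident (fcod q) (fob q z)) \<in> arr (fdom q)"
      and q: "far q (?l z (ident (fcod q) (fob q z))) = far q (ident (fdom q) z)"
      using k(1) by (simp_all only: is_lifting_def q.far_ident[OF z])
    show "?l z (ident (fcod q) (fob q z)) = ident (fdom q) z"
      by (rule unique[OF arr Q.ident_closed[OF z] q g])
  qed
qed

end

theory Submission
  imports Defs
begin

text \<open>By choice, every fibration of groupoids has a normal cleavage, so the class in question is
  that of isofibrations. Pullbacks are the strict ones. The path groupoid of \<open>p\<close> has the
  \<open>p\<close>-vertical arrows as objects and the commutative squares between them as arrows. The
  reflexivity functor is an injective equivalence; such functors are stable under base change
  along isofibrations, and they lift against isofibrations: transport along chosen liftings,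
  with normality ensuring that the filler restricts to the given functor. Stability of path
  objects is again a lifting problem, of the injective equivalence from \<open>F\<close> to \<open>Map\<close> against an
  isofibration.\<close>

section \<open>Categories and groupoids\<close>

text \<open>All groupoids have their objects and arrows in the single type \<open>'u\<close>, so
  pullbacks and path groupoids, whose elements are pairs and triples, must be coded back into
  \<open>'u\<close>. A bijection between \<open>'u\<close> and its square does this. It exists
  because the infinite cardinal \<kappa> lives on \<open>'u\<close>, and coded products stay small
  because \<kappa> is infinite. The axioms of a tribe speak of arbitrary pullbacks; an isomorphism
  with the coded one shows that each of them is strict on objects and arrows. Chosen liftings need
  not respect composition. The filler of a lifting problem is therefore defined on arrows by
  conjugation with liftings, which in a groupoid is functorial whatever the choice. In the stability
  problem, the functor into \<open>Map\<close> is a base change of reflexivity, but along a base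
  change of an arbitrary functor, so closure under base change along isofibrations does not apply to
  it. It is an injective equivalence because a vertical arrow contracts to the constant path at its
  start without moving that start.\<close>

lemmas (in category) category_simps =
  src_closed tgt_closed ident_closed src_ident tgt_ident cmp_closed src_cmp tgt_cmp
  cmp_ident ident_cmp cmp_assoc

text \<open>The comparison arrows in the two directions compose to endomorphisms compatible with
  both projections, and by uniqueness these are identities. This carries what is known about one
  explicit pullback over to all others.\<close>

lemma (in category) pullback_comparison:
  assumes "is_pullback C f g p q" "is_pullback C f g p' q'"
  obtains h where "isomorphism C h" "src C h = src C p" "tgt C h = src C p'"
    "p' \<cdot> h = p" "q' \<cdot> h = q"
proof -
  have *: "\<exists>h. h \<in> hom C (src C p1) (src C p2) \<and> p2 \<cdot> h = p1 \<and> q2 \<cdot> h = q1"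
    if "is_pullback C f g p1 q1" "is_pullback C f g p2 q2" for p1 q1 p2 q2
    using that unfolding is_pullback_def by metis
  have uniq: "k = ident C (src C p1)"
    if pb: "is_pullback C f g p1 q1"
      and k: "k \<in> hom C (src C p1) (src C p1)" "p1 \<cdot> k = p1" "q1 \<cdot> k = q1"
    for p1 q1 k
  proof -
    have P: "p1 \<in> arr C" "q1 \<in> arr C" "src C q1 = src C p1"
      using pb by (auto simp: is_pullback_def)
    have "\<exists>!h. h \<in> hom C (src C p1) (src C p1) \<and> p1 \<cdot> h = p1 \<and> q1 \<cdot> h = q1"
      using pb unfolding is_pullback_def by metis
    moreover have "ident C (src C p1) \<in> hom C (src C p1) (src C p1)" "p1 \<cdot> ident C (src C p1) = p1"
      "q1 \<cdot> ident C (src C p1) = q1"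
      using P cmp_ident[of q1] by (auto simp: hom_def category_simps)
    ultimately show ?thesis
      using k by blast
  qed
  obtain h where h: "h \<in> hom C (src C p) (src C p')" "p' \<cdot> h = p" "q' \<cdot> h = q"
    using *[OF assms] by blast
  obtain k where k: "k \<in> hom C (src C p') (src C p)" "p \<cdot> k = p'" "q \<cdot> k = q'"
    using *[OF assms(2,1)] by blast
  have P: "p \<in> arr C" "q \<in> arr C" "p' \<in> arr C" "q' \<in> arr C" "src C q = src C p"
    "src C q' = src C p'"
    using assms by (auto simp: is_pullback_def)
  have "k \<cdot> h = ident C (src C p)"
    by (rule uniq[OF assms(1)])
      (use h k P in \<open>auto simp: hom_def src_cmp tgt_cmp cmp_closed cmp_assoc[symmetric]\<close>)
  moreover have "h \<cdot> k = ident C (src C p')"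
    by (rule uniq[OF assms(2)])
      (use h k P in \<open>auto simp: hom_def src_cmp tgt_cmp cmp_closed cmp_assoc[symmetric]\<close>)
  ultimately have "isomorphism C h"
    using h(1) k(1) by (auto simp: isomorphism_def hom_def)
  then show ?thesis
    using that h by (auto simp: hom_def)
qed

text \<open>The record of a category has no inverse operation, so one is chosen; in a groupoid the
  choice is forced by \<open>inverse_arrow_unique\<close>.\<close>

definition inverse_arrow :: "('o, 'a) cat \<Rightarrow> 'a \<Rightarrow> 'a" where
  "inverse_arrow A f = (SOME g. g \<in> hom A (tgt A f) (src A f) \<and>
     g \<cdot>\<^bsub>A\<^esub> f = ident A (src A f) \<and> f \<cdot>\<^bsub>A\<^esub> g = ident A (tgt A f))"

context groupoid
begin

lemma inverse_arrow:
  assumes "f \<in> arr C"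
  shows "inverse_arrow C f \<in> arr C" "src C (inverse_arrow C f) = tgt C f"
    "tgt C (inverse_arrow C f) = src C f" "inverse_arrow C f \<cdot> f = ident C (src C f)"
    "f \<cdot> inverse_arrow C f = ident C (tgt C f)"
proof -
  have "\<exists>g. g \<in> hom C (tgt C f) (src C f) \<and> g \<cdot> f = ident C (src C f) \<and> f \<cdot> g = ident C (tgt C f)"
    using all_isomorphisms[OF assms] by (auto simp: isomorphism_def)
  then have "inverse_arrow C f \<in> hom C (tgt C f) (src C f) \<and>
      inverse_arrow C f \<cdot> f = ident C (src C f) \<and> f \<cdot> inverse_arrow C f = ident C (tgt C f)"
    unfolding inverse_arrow_def by (rule someI_ex)
  then show "inverse_arrow C f \<in> arr C" "src C (inverse_arrow C f) = tgt C f"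
    "tgt C (inverse_arrow C f) = src C f" "inverse_arrow C f \<cdot> f = ident C (src C f)"
    "f \<cdot> inverse_arrow C f = ident C (tgt C f)"
    by (simp_all add: hom_def)
qed

text \<open>These are the cancellations that remain visible once \<open>cmp_assoc\<close> has
  bracketed every composite to the right.\<close>

lemma inverse_arrow_cmp_cancel:
  assumes "f \<in> arr C" "g \<in> arr C"
  shows "tgt C g = src C f \<Longrightarrow> inverse_arrow C f \<cdot> f \<cdot> g = g"
    and "tgt C g = tgt C f \<Longrightarrow> f \<cdot> inverse_arrow C f \<cdot> g = g"
  using assms cmp_assoc[of g f "inverse_arrow C f"] cmp_assoc[of g "inverse_arrow C f" f]
    ident_cmp[OF assms(2)]
  by (metis inverse_arrow)+

text \<open>A left inverse suffices: insert the composite of \<open>f\<close> and its inverse on the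
  right of \<open>g\<close> and reassociate.\<close>

lemma inverse_arrow_unique:
  assumes "f \<in> arr C" "g \<in> arr C" "tgt C f = src C g" "g \<cdot> f = ident C (src C f)"
  shows "inverse_arrow C f = g"
proof -
  have "g = g \<cdot> f \<cdot> inverse_arrow C f"
    using assms cmp_ident[of g] by (metis inverse_arrow(5))
  also have "\<dots> = (g \<cdot> f) \<cdot> inverse_arrow C f"
    by (rule cmp_assoc[symmetric]) (use assms in \<open>simp_all add: inverse_arrow\<close>)
  also have "\<dots> = inverse_arrow C f"
    using assms ident_cmp[of "inverse_arrow C f"] by (simp add: inverse_arrow)
  finally show ?thesis ..
qed

lemma inverse_arrow_ident: "X \<in> obj C \<Longrightarrow> inverse_arrow C (ident C X) = ident C X"
  by (rule inverse_arrow_unique) (use cmp_ident[of "ident C X"] in \<open>auto simp: category_simps\<close>)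

end


section \<open>Stability of path objects from a lifting problem\<close>

context tribe
begin

lemma chosen_pullback_projections:
  assumes "f \<in> arr C" "g \<in> arr C" "tgt C f = tgt C g" "f \<in> \<A> \<or> g \<in> \<A>"
  shows "pr0 f g \<in> arr C" "pr1 f g \<in> arr C" "src C (pr0 f g) = apex f g"
    "src C (pr1 f g) = apex f g"
    "tgt C (pr0 f g) = src C f" "tgt C (pr1 f g) = src C g" "f \<cdot> pr0 f g = g \<cdot> pr1 f g"
    "g \<in> \<A> \<Longrightarrow> pr0 f g \<in> \<A>"
  using chosen_pullback[OF assms] class_base_change[OF chosen_pullback[OF assms]]
  by (auto simp: is_pullback_def pr0_def pr1_def apex_def)

lemma pairing:
  assumes "f \<in> arr C" "g \<in> arr C" "tgt C f = tgt C g" "f \<in> \<A> \<or> g \<in> \<A>"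
    and "u \<in> arr C" "v \<in> arr C" "src C u = src C v" "tgt C u = src C f" "tgt C v = src C g"
    and "f \<cdot> u = g \<cdot> v"
  shows "pairing f g u v \<in> hom C (src C u) (apex f g)"
    and "pr0 f g \<cdot> pairing f g u v = u" "pr1 f g \<cdot> pairing f g u v = v"
    and "\<lbrakk>h \<in> hom C (src C u) (apex f g); pr0 f g \<cdot> h = u; pr1 f g \<cdot> h = v\<rbrakk> \<Longrightarrow> pairing f g u v = h"
proof -
  have ex1: "\<exists>!h. h \<in> hom C (src C u) (apex f g) \<and> pr0 f g \<cdot> h = u \<and> pr1 f g \<cdot> h = v"
    using chosen_pullback[OF assms(1-4)] assms(5-10)
    unfolding is_pullback_def pr0_def pr1_def apex_def by blast
  from theI'[OF this]
  show "pairing f g u v \<in> hom C (src C u) (apex f g)"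
    "pr0 f g \<cdot> pairing f g u v = u" "pr1 f g \<cdot> pairing f g u v = v"
    by (simp_all add: pairing_def)
  then show "pairing f g u v = h"
    if "h \<in> hom C (src C u) (apex f g)" "pr0 f g \<cdot> h = u" "pr1 f g \<cdot> h = v"
    using ex1 that by blast
qed

end

context tribe_with_path_objects
begin

lemma bd_arr: "p \<in> \<A> \<Longrightarrow> \<partial> p \<in> arr C" "p \<in> \<A> \<Longrightarrow> p \<in> arr C"
  using bd_class class_arr by blast+

lemma diagonal:
  assumes "p \<in> \<A>"
  shows "diagonal p \<in> hom C (src C p) (apex p p)"
    "pr0 p p \<cdot> diagonal p = ident C (src C p)" "pr1 p p \<cdot> diagonal p = ident C (src C p)"
  using pairing(1-3)[of p p "ident C (src C p)" "ident C (src C p)"] assms bd_arr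
  by (simp_all add: diagonal_def category_simps)

text \<open>The projection \<open>pr0 p p\<close> is a base change of \<open>p\<close>, so
  \<open>\<partial>\<^sup>0 p\<close> is a composite of two arrows of the class. This is what
  provides the chosen pullback defining \<open>Map p g\<close> for every \<open>g\<close>.\<close>

lemma bd0_bd1:
  assumes p: "p \<in> \<A>"
  shows "\<partial>\<^sup>0 p \<in> \<A>" "\<partial>\<^sup>1 p \<in> arr C" "src C (\<partial>\<^sup>0 p) = Path p" "src C (\<partial>\<^sup>1 p) = Path p"
    "tgt C (\<partial>\<^sup>0 p) = src C p" "tgt C (\<partial>\<^sup>1 p) = src C p"
    "p \<cdot> \<partial>\<^sup>0 p = p \<cdot> \<partial>\<^sup>1 p"
    "\<partial>\<^sup>0 p \<cdot> r p = ident C (src C p)" "\<partial>\<^sup>1 p \<cdot> r p = ident C (src C p)"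
proof -
  note pp = chosen_pullback_projections[OF bd_arr(2)[OF p] bd_arr(2)[OF p] refl disjI1[OF p]]
  show "\<partial>\<^sup>0 p \<in> \<A>" "\<partial>\<^sup>1 p \<in> arr C" "src C (\<partial>\<^sup>0 p) = Path p" "src C (\<partial>\<^sup>1 p) = Path p"
    "tgt C (\<partial>\<^sup>0 p) = src C p" "tgt C (\<partial>\<^sup>1 p) = src C p"
    using pp p bd_class[OF p] bd_arr[OF p] bd_tgt[OF p]
    by (simp_all add: bd0_def bd1_def Path_def category_simps class_cmp)
  show "p \<cdot> \<partial>\<^sup>0 p = p \<cdot> \<partial>\<^sup>1 p"
    using pp p bd_arr[OF p] bd_tgt[OF p] by (simp add: bd0_def bd1_def flip: cmp_assoc)
  show "\<partial>\<^sup>0 p \<cdot> r p = ident C (src C p)" "\<partial>\<^sup>1 p \<cdot> r p = ident C (src C p)"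
    using pp p bd_arr[OF p] bd_tgt[OF p] r_arr[OF p] bd_r[OF p] diagonal[OF p]
    by (simp_all add: bd0_def bd1_def hom_def cmp_assoc)
qed

text \<open>The two conditions on \<open>i\<close> say that it is a diagonal filler of a commutative square with
  \<open>j\<close> on the left and \<open>\<partial> fp\<close> on the right.\<close>

lemma stable_path_objects_of_lifting:
  assumes p: "p \<in> \<A>" and f: "f \<in> arr C" and pf: "tgt C f = tgt C p"
    and fp_def: "fp = pr0 f p" and pf_def: "pf = pr1 f p"
  defines "j \<equiv> pairing pf (\<partial>\<^sup>0 p) (ident C (apex f p)) (r p \<cdot> pf)"
  assumes lift: "\<lbrakk>j \<in> hom C (apex f p) (Map p pf); pm0 p pf \<cdot> j = ident C (apex f p);
    pm1 p pf \<cdot> j = r p \<cdot> pf; fp \<in> \<A>\<rbrakk> \<Longrightarrow> left_lifting C j (\<partial> fp)"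
  shows "\<exists>i \<in> hom C (Map p pf) (Path fp). i \<cdot> j = r fp \<and>
    \<partial> fp \<cdot> i = pairing fp fp (pm0 p pf) (pairing f p (fp \<cdot> pm0 p pf) (\<partial>\<^sup>1 p \<cdot> pm1 p pf))"
proof -
  let ?F = "apex f p" and ?m0 = "pm0 p pf" and ?m1 = "pm1 p pf"
  have p_arr: "p \<in> arr C" using p by (rule bd_arr)
  note fp = chosen_pullback_projections[OF f p_arr pf disjI2[OF p], folded fp_def pf_def]
  note fp_class = fp(8)[OF p]
  note b = bd0_bd1[OF p]
  have b0: "\<partial>\<^sup>0 p \<in> arr C" using b(1) class_arr by blast
  have F: "?F \<in> obj C" using fp(3) src_closed[OF fp(1)] by simp
  have r: "r p \<in> arr C" "src C (r p) = src C p" "tgt C (r p) = Path p"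
    using r_arr[OF p] by (auto simp: hom_def Path_def)
  note m = chosen_pullback_projections[OF fp(2) b0 _ disjI2[OF b(1)], folded pm0_def pm1_def Map_def]
  have m: "?m0 \<in> arr C" "?m1 \<in> arr C" "src C ?m0 = Map p pf" "src C ?m1 = Map p pf"
    "tgt C ?m0 = ?F" "tgt C ?m1 = Path p" "pf \<cdot> ?m0 = \<partial>\<^sup>0 p \<cdot> ?m1"
    using m(1-7) fp b by auto
  \<comment> \<open>The compatibility that makes \<open>j\<close> an arrow into the pullback
    \<open>Map p pf\<close>: a constant path starts at its point.\<close>
  have "pf \<cdot> ident C ?F = \<partial>\<^sup>0 p \<cdot> r p \<cdot> pf"
    using fp b b0 r cmp_ident[OF fp(2)] ident_cmp[OF fp(2)] by (simp flip: cmp_assoc)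
  note jj = pairing[OF fp(2) b0 _ disjI2[OF b(1)] ident_closed[OF F] cmp_closed[OF fp(2) r(1)]
      _ _ _ this,
      folded j_def pm0_def pm1_def Map_def]
  have j: "j \<in> hom C ?F (Map p pf)" "?m0 \<cdot> j = ident C ?F" "?m1 \<cdot> j = r p \<cdot> pf"
    using jj(1-3) fp b r F by (auto simp: category_simps)
  have j_arr: "j \<in> arr C" "src C j = ?F" "tgt C j = Map p pf"
    using j(1) by (auto simp: hom_def)
  \<comment> \<open>\<open>?l\<close> moves a point of \<open>F\<close> to the end of a path
    starting at its image in \<open>E\<close>. The result lies in \<open>F\<close> because both ends
    of a path have the same image under \<open>p\<close>.\<close>
  let ?l = "pairing f p (fp \<cdot> ?m0) (\<partial>\<^sup>1 p \<cdot> ?m1)"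
  have "f \<cdot> fp \<cdot> ?m0 = p \<cdot> \<partial>\<^sup>1 p \<cdot> ?m1"
  proof -
    have "f \<cdot> fp \<cdot> ?m0 = (p \<cdot> pf) \<cdot> ?m0"
      using fp m f by (simp flip: cmp_assoc)
    also have "\<dots> = p \<cdot> \<partial>\<^sup>0 p \<cdot> ?m1"
      using fp m p_arr by (simp add: cmp_assoc)
    also have "\<dots> = (p \<cdot> \<partial>\<^sup>1 p) \<cdot> ?m1"
      using m p_arr b b0 by (simp flip: cmp_assoc)
    finally show ?thesis
      using m p_arr b by (simp add: cmp_assoc)
  qed
  note ll = pairing[OF f p_arr pf disjI2[OF p] _ _ _ _ _ this, folded fp_def pf_def]
  have l: "?l \<in> hom C (Map p pf) ?F" "fp \<cdot> ?l = fp \<cdot> ?m0" "pf \<cdot> ?l = \<partial>\<^sup>1 p \<cdot> ?m1"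
    using ll(1-3) fp m b by (auto simp: category_simps)
  have l_arr: "?l \<in> arr C" "src C ?l = Map p pf" "tgt C ?l = ?F"
    using l(1) by (auto simp: hom_def)
  let ?k = "pairing fp fp ?m0 ?l"
  note ff = chosen_pullback_projections[OF fp(1) fp(1) refl disjI1[OF fp_class]]
  note kk = pairing[OF fp(1) fp(1) refl disjI1[OF fp_class] m(1) l_arr(1) _ _ _ l(2)[symmetric]]
  have k: "?k \<in> hom C (Map p pf) (apex fp fp)" "pr0 fp fp \<cdot> ?k = ?m0" "pr1 fp fp \<cdot> ?k = ?l"
    using kk(1-3) fp m l_arr by auto
  have k_arr: "?k \<in> arr C" "src C ?k = Map p pf" "tgt C ?k = apex fp fp"
    using k(1) by (auto simp: hom_def)
  \<comment> \<open>Moving along a constant path changes nothing. Both arrows have the projections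
    \<open>fp\<close> and \<open>pf\<close>, so uniqueness of the pairing identifies them.\<close>
  have lj: "?l \<cdot> j = ident C ?F"
  proof -
    note un = pairing(4)[OF f p_arr pf disjI2[OF p] fp(1,2) _ _ _ fp(7), folded fp_def pf_def]
    have "fp \<cdot> ?l \<cdot> j = (fp \<cdot> ?m0) \<cdot> j"
      using l l_arr j_arr fp by (simp flip: cmp_assoc)
    also have "\<dots> = fp"
      using m j j_arr fp cmp_ident[OF fp(1)] by (simp add: cmp_assoc)
    finally have 1: "fp \<cdot> ?l \<cdot> j = fp" .
    have "pf \<cdot> ?l \<cdot> j = (\<partial>\<^sup>1 p \<cdot> ?m1) \<cdot> j"
      using l l_arr j_arr fp by (simp flip: cmp_assoc)
    also have "\<dots> = \<partial>\<^sup>1 p \<cdot> r p \<cdot> pf"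
      using m j j_arr b by (simp add: cmp_assoc)
    also have "\<dots> = pf"
      using fp b r ident_cmp[OF fp(2)] by (simp flip: cmp_assoc)
    finally have 2: "pf \<cdot> ?l \<cdot> j = pf" .
    have "pairing f p fp pf = ?l \<cdot> j"
      by (rule un) (use fp 1 2 l_arr j_arr in \<open>simp_all add: hom_def category_simps\<close>)
    moreover have "pairing f p fp pf = ident C ?F"
      by (rule un) (use fp F cmp_ident[OF fp(1)] cmp_ident[OF fp(2)]
        in \<open>simp_all add: hom_def category_simps\<close>)
    ultimately show ?thesis by simp
  qed
  have "pr0 fp fp \<cdot> ?k \<cdot> j = (pr0 fp fp \<cdot> ?k) \<cdot> j" "pr1 fp fp \<cdot> ?k \<cdot> j = (pr1 fp fp \<cdot> ?k) \<cdot> j"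
    using k_arr j_arr ff by (simp_all add: cmp_assoc)
  then have "diagonal fp = ?k \<cdot> j"
    unfolding diagonal_def
    by (intro pairing(4)[OF fp(1) fp(1) refl disjI1[OF fp_class]])
      (use k k_arr j j_arr lj fp F in \<open>simp_all add: hom_def category_simps\<close>)
  \<comment> \<open>Both components of \<open>?k \<cdot> j\<close> are identities, so it is the
    diagonal, and the square to be filled commutes.\<close>
  then have sq: "\<partial> fp \<cdot> r fp = ?k \<cdot> j"
    using bd_r[OF fp_class] by simp
  show ?thesis
    using lift[OF j fp_class] sq r_arr[OF fp_class] k bd_tgt[OF fp_class] fp(3)
    unfolding left_lifting_def j_arr by (auto simp: Path_def)
qed

end

section \<open>Functors\<close>

context is_functor
begin

lemma fob_in: "X \<in> obj (fdom F) \<Longrightarrow> fob F X \<in> obj (fcod F)"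
  using fob_closed by (auto simp: PiE_iff)

lemma far_in: "f \<in> arr (fdom F) \<Longrightarrow> far F f \<in> arr (fcod F)"
  using far_closed by (auto simp: PiE_iff)

lemma fob_eq: "X \<in> obj (fdom F) \<Longrightarrow> fob F X = src (fcod F) (far F (ident (fdom F) X))"
  by (simp add: far_src category.ident_closed[OF fdom_category]
    category.src_ident[OF fdom_category])

lemma far_inverse_arrow:
  assumes "groupoid (fdom F)" "groupoid (fcod F)" "f \<in> arr (fdom F)"
  shows "far F (inverse_arrow (fdom F) f) = inverse_arrow (fcod F) (far F f)"
proof -
  interpret A: groupoid "fdom F" by fact
  interpret B: groupoid "fcod F" by fact
  show ?thesis
    by (rule B.inverse_arrow_unique[symmetric])
      (use assms(3) in \<open>auto simp: far_in far_src far_tgt A.inverse_arrow A.src_closed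
         far_cmp[symmetric] far_ident\<close>)
qed

end

text \<open>The arrow part determines the object part, since an object can be read off as the source
  of its identity; extensionality settles the values outside the domain. Equations of functors thus
  need checking on arrows only.\<close>

lemma functor_eqI:
  assumes "is_functor F" "is_functor G" "fdom F = fdom G" "fcod F = fcod G"
    and "\<And>f. f \<in> arr (fdom F) \<Longrightarrow> far F f = far G f"
  shows "F = G"
proof -
  interpret F: is_functor F by fact
  interpret G: is_functor G by fact
  have "far F = far G"
    using F.far_closed G.far_closed assms(3-5) by (metis PiE_ext)
  moreover have "fob F = fob G"
  proof (rule PiE_ext)
    show "fob F X = fob G X" if "X \<in> obj (fdom F)" for X
      using that assms(3,4) \<open>far F = far G\<close> by (simp add: F.fob_eq G.fob_eq)
  qed (use F.fob_closed G.fob_closed assms(3,4) in auto)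
  ultimately show ?thesis
    using assms(3,4) by (intro ftor.equality) simp_all
qed

lemma is_functorI:
  assumes "category (fdom F)" "category (fcod F)"
    and "fob F \<in> extensional (obj (fdom F))" "far F \<in> extensional (arr (fdom F))"
    and "\<And>X. X \<in> obj (fdom F) \<Longrightarrow> fob F X \<in> obj (fcod F)"
    and far: "\<And>f. f \<in> arr (fdom F) \<Longrightarrow>
      far F f \<in> hom (fcod F) (fob F (src (fdom F) f)) (fob F (tgt (fdom F) f))"
    and "\<And>X. X \<in> obj (fdom F) \<Longrightarrow> far F (ident (fdom F) X) = ident (fcod F) (fob F X)"
    and "\<And>f g. \<lbrakk>f \<in> arr (fdom F); g \<in> arr (fdom F); tgt (fdom F) f = src (fdom F) g\<rbrakk>
      \<Longrightarrow> far F (g \<cdot>\<^bsub>fdom F\<^esub> f) = far F g \<cdot>\<^bsub>fcod F\<^esub> far F f"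
  shows "is_functor F"
  using assms by (auto simp: is_functor_def PiE_iff hom_def)

lemma is_functor_id: "category A \<Longrightarrow> is_functor (id_functor A)"
  by (rule is_functorI) (auto simp: id_functor_def category.category_simps hom_def)

lemma comp_functor_simps [simp]:
  "fdom (comp_functor G F) = fdom F" "fcod (comp_functor G F) = fcod G"
  "X \<in> obj (fdom F) \<Longrightarrow> fob (comp_functor G F) X = fob G (fob F X)"
  "f \<in> arr (fdom F) \<Longrightarrow> far (comp_functor G F) f = far G (far F f)"
  by (simp_all add: comp_functor_def compose_def)

lemma id_functor_simps [simp]:
  "fdom (id_functor A) = A" "fcod (id_functor A) = A"
  "X \<in> obj A \<Longrightarrow> fob (id_functor A) X = X" "f \<in> arr A \<Longrightarrow> far (id_functor A) f = f"
  by (simp_all add: id_functor_def)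

lemma is_functor_comp:
  assumes "is_functor F" "is_functor G" "fcod F = fdom G"
  shows "is_functor (comp_functor G F)"
proof -
  interpret F: is_functor F by fact
  interpret G: is_functor G by fact
  interpret A: category "fdom F" by (rule F.fdom_category)
  show ?thesis
    by (rule is_functorI)
      (use assms(3) F.fdom_category G.fcod_category F.fob_in F.far_in F.far_src F.far_tgt
        F.far_ident F.far_cmp G.fob_in G.far_in
          G.far_src G.far_tgt G.far_ident G.far_cmp
        in \<open>auto simp: A.category_simps hom_def comp_functor_def compose_def extensional_def\<close>)
qed


section \<open>The category of small groupoids\<close>

lemma Gpd_simps [simp]:
  "obj (Gpd \<kappa>) = {A. small_groupoid \<kappa> A}"
  "arr (Gpd \<kappa>) = {F. is_functor F \<and> small_groupoid \<kappa> (fdom F) \<and> small_groupoid \<kappa> (fcod F)}"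
  "src (Gpd \<kappa>) = fdom" "tgt (Gpd \<kappa>) = fcod" "ident (Gpd \<kappa>) = id_functor"
  "cmp (Gpd \<kappa>) = comp_functor"
  by (simp_all add: Gpd_def)

lemma small_groupoid_imp_groupoid: "small_groupoid \<kappa> A \<Longrightarrow> groupoid A"
  and small_groupoid_imp_category: "small_groupoid \<kappa> A \<Longrightarrow> category A"
  by (auto simp: small_groupoid_def groupoid_def)

lemma hom_Gpd:
  "F \<in> hom (Gpd \<kappa>) A B \<longleftrightarrow>
     is_functor F \<and> small_groupoid \<kappa> A \<and> small_groupoid \<kappa> B \<and> fdom F = A \<and> fcod F = B"
  by (auto simp: hom_def)

lemma category_Gpd: "category (Gpd \<kappa>)"
proof
  fix F assume F: "F \<in> arr (Gpd \<kappa>)"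
  then interpret F: is_functor F by simp
  show "F \<cdot>\<^bsub>Gpd \<kappa>\<^esub> ident (Gpd \<kappa>) (src (Gpd \<kappa>) F) = F"
    by (rule functor_eqI)
      (simp_all add: is_functor_comp is_functor_id F.fdom_category F.is_functor_axioms)
  show "ident (Gpd \<kappa>) (tgt (Gpd \<kappa>) F) \<cdot>\<^bsub>Gpd \<kappa>\<^esub> F = F"
    by (rule functor_eqI)
      (simp_all add: is_functor_comp is_functor_id F.fcod_category F.is_functor_axioms F.far_in)
  fix G H
  assume "G \<in> arr (Gpd \<kappa>)" "H \<in> arr (Gpd \<kappa>)" "tgt (Gpd \<kappa>) F = src (Gpd \<kappa>) G"
    "tgt (Gpd \<kappa>) G = src (Gpd \<kappa>) H"
  then have G: "is_functor G" "is_functor H" "fcod F = fdom G" "fcod G = fdom H"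
    by simp_all
  show "(H \<cdot>\<^bsub>Gpd \<kappa>\<^esub> G) \<cdot>\<^bsub>Gpd \<kappa>\<^esub> F = H \<cdot>\<^bsub>Gpd \<kappa>\<^esub> G \<cdot>\<^bsub>Gpd \<kappa>\<^esub> F"
    by (rule functor_eqI)
      (use G F.far_in in \<open>simp_all add: is_functor_comp F.is_functor_axioms\<close>)
qed (auto simp: is_functor_id is_functor_comp small_groupoid_imp_category)

lemma isomorphism_Gpd_bij:
  assumes "isomorphism (Gpd \<kappa>) F"
  shows "bij_betw (fob F) (obj (fdom F)) (obj (fcod F))"
    and "bij_betw (far F) (arr (fdom F)) (arr (fcod F))"
proof -
  obtain G where G: "is_functor G" "fdom G = fcod F" "fcod G = fdom F"
    "comp_functor G F = id_functor (fdom F)" "comp_functor F G = id_functor (fcod F)"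
    using assms by (auto simp: isomorphism_def hom_Gpd)
  interpret F: is_functor F
    using assms by (auto simp: isomorphism_def)
  interpret G: is_functor G by fact
  show "bij_betw (fob F) (obj (fdom F)) (obj (fcod F))"
  proof (rule bij_betw_byWitness)
    show "\<forall>x\<in>obj (fdom F). fob G (fob F x) = x"
      using arg_cong[OF G(4), of fob] by (metis comp_functor_simps(3) id_functor_simps(3))
    show "\<forall>x\<in>obj (fcod F). fob F (fob G x) = x"
      using arg_cong[OF G(5), of fob] G(2) by (metis comp_functor_simps(3) id_functor_simps(3))
  qed (use F.fob_in G.fob_in G in auto)
  show "bij_betw (far F) (arr (fdom F)) (arr (fcod F))"
  proof (rule bij_betw_byWitness)
    show "\<forall>x\<in>arr (fdom F). far G (far F x) = x"
      using arg_cong[OF G(4), of far] by (metis comp_functor_simps(4) id_functor_simps(4))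
    show "\<forall>x\<in>arr (fcod F). far F (far G x) = x"
      using arg_cong[OF G(5), of far] G(2) by (metis comp_functor_simps(4) id_functor_simps(4))
  qed (use F.far_in G.far_in G in auto)
qed

section \<open>Isofibrations\<close>

lemma cleavage_imp_Grothendieck_fibration:
  "\<lbrakk>is_functor p; cleavage p l\<rbrakk> \<Longrightarrow> Grothendieck_fibration p"
  by (auto simp: Grothendieck_fibration_def cleavage_def)

text \<open>From here on, membership in the class is shown by exhibiting single liftings, while a
  normal choice of liftings can still be extracted whenever one is wanted.\<close>

lemma normal_cloven_fibrations_iff:
  "p \<in> normal_cloven_fibrations \<kappa> \<longleftrightarrow> p \<in> arr (Gpd \<kappa>) \<and> Grothendieck_fibration p"
proof
  assume p: "p \<in> arr (Gpd \<kappa>) \<and> Grothendieck_fibration p"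
  interpret is_functor p using p by simp
  interpret E: category "fdom p" by (rule fdom_category)
  \<comment> \<open>An arbitrary choice is overridden at identities, which is harmless because an
    identity does lift an identity.\<close>
  define l where "l e a = (if a = ident (fcod p) (fob p e) then ident (fdom p) e
    else SOME b. is_lifting p e a b)" for e a
  have "cleavage p l"
    unfolding cleavage_def
  proof (intro ballI impI)
    fix e a assume *: "e \<in> obj (fdom p)" "a \<in> arr (fcod p)" "src (fcod p) a = fob p e"
    then have "\<exists>b. is_lifting p e a b"
      using p by (auto simp: Grothendieck_fibration_def)
    then have "is_lifting p e a (SOME b. is_lifting p e a b)"
      by (rule someI_ex)
    moreover have "is_lifting p e (ident (fcod p) (fob p e)) (ident (fdom p) e)"
      using * by (simp add: is_lifting_def far_ident E.category_simps)
    ultimately show "is_lifting p e a (l e a)"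
      by (simp add: l_def)
  qed
  moreover have "normal p l"
    by (simp add: normal_def l_def)
  ultimately show "p \<in> normal_cloven_fibrations \<kappa>"
    using p by (auto simp: normal_cloven_fibrations_def)
qed (auto simp: normal_cloven_fibrations_def)

lemma normal_cloven_fibrations_comp:
  assumes "p \<in> normal_cloven_fibrations \<kappa>" "q \<in> normal_cloven_fibrations \<kappa>" "fcod p = fdom q"
  shows "comp_functor q p \<in> normal_cloven_fibrations \<kappa>"
proof -
  obtain l m where "cleavage p l" "cleavage q m"
    using assms by (auto simp: normal_cloven_fibrations_def)
  then have "cleavage (comp_functor q p) (comp_cleavage p l m)"
    using assms by (intro comp_cleavage(1)) (auto simp: normal_cloven_fibrations_iff)
  then show ?thesis
    using assms
      by (auto simp: normal_cloven_fibrations_iff is_functor_comp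
        intro: cleavage_imp_Grothendieck_fibration)
qed

text \<open>The preimage of an arrow serves as its lifting; injectivity on objects forces the
  preimage to start at the prescribed object.\<close>

lemma isomorphism_normal_cloven_fibration:
  assumes "isomorphism (Gpd \<kappa>) F"
  shows "F \<in> normal_cloven_fibrations \<kappa>"
proof -
  have F: "F \<in> arr (Gpd \<kappa>)"
    using assms by (simp add: isomorphism_def)
  interpret is_functor F using F by simp
  interpret A: category "fdom F" by (rule fdom_category)
  have "\<exists>b. is_lifting F e a b"
    if e: "e \<in> obj (fdom F)" "src (fcod F) a = fob F e" and a: "a \<in> arr (fcod F)" for e a
  proof -
    obtain b where b: "b \<in> arr (fdom F)" "far F b = a"
      using isomorphism_Gpd_bij(2)[OF assms] a by (metis bij_betw_imp_surj_on imageE)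
    then have "src (fdom F) b = e"
      using isomorphism_Gpd_bij(1)[OF assms] e A.src_closed[OF b(1)] far_src[OF b(1)]
      by (auto simp: bij_betw_def inj_on_def)
    then show ?thesis
      using b by (auto simp: is_lifting_def)
  qed
  then show ?thesis
    using F by (auto simp: normal_cloven_fibrations_iff Grothendieck_fibration_def)
qed

definition const_functor :: "('o, 'a) cat \<Rightarrow> ('o, 'a) cat \<Rightarrow> 'o \<Rightarrow> ('o, 'a) ftor" where
  "const_functor A B t =
     \<lparr>fdom = A, fcod = B, fob = (\<lambda>_ \<in> obj A. t), far = (\<lambda>_ \<in> arr A. ident B t)\<rparr>"

lemma is_functor_const:
  assumes "category A" "category B" "t \<in> obj B"
  shows "is_functor (const_functor A B t)"
proof -
  interpret A: category A by fact
  interpret B: category B by fact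
  show ?thesis
    using assms(3) B.cmp_ident[of "ident B t"]
    by (intro is_functorI)
      (auto simp: const_functor_def hom_def A.category_simps B.category_simps A.category_axioms
        B.category_axioms)
qed

text \<open>The terminal groupoid is arbitrary, so it must be shown to have only identities. Its
  identity functor and its constant endofunctor at \<open>t\<close> are arrows from \<open>T\<close>
  to \<open>T\<close> and hence equal. Lifting along a functor into \<open>T\<close> is then lifting
  of identities.\<close>

lemma terminal_Gpd_arr:
  assumes "terminal (Gpd \<kappa>) T" "t \<in> obj T" "a \<in> arr T"
  shows "a = ident T t"
proof -
  have T: "small_groupoid \<kappa> T"
    using assms(1) by (simp add: terminal_def)
  then have "const_functor T T t \<in> hom (Gpd \<kappa>) T T" "id_functor T \<in> hom (Gpd \<kappa>) T T"
    using assms(2) small_groupoid_imp_category[OF T]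
    by (auto simp: hom_Gpd is_functor_const is_functor_id) (simp_all add: const_functor_def)
  then have "id_functor T = const_functor T T t"
    using assms(1) T by (auto simp: terminal_def)
  then have "far (id_functor T) a = far (const_functor T T t) a"
    by simp
  then show ?thesis
    using assms(3) by (simp add: const_functor_def)
qed

lemma terminal_normal_cloven_fibration:
  assumes f: "f \<in> arr (Gpd \<kappa>)" and T: "terminal (Gpd \<kappa>) (fcod f)"
  shows "f \<in> normal_cloven_fibrations \<kappa>"
proof -
  interpret f: is_functor f using f by simp
  interpret A: category "fdom f" by (rule f.fdom_category)
  have "is_lifting f e a (ident (fdom f) e)" if "e \<in> obj (fdom f)" "a \<in> arr (fcod f)" for e a
    using that terminal_Gpd_arr[OF T, of "fob f e" a]
    by (simp add: is_lifting_def A.category_simps f.far_ident f.fob_in)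
  then show ?thesis
    using f by (auto simp: normal_cloven_fibrations_iff Grothendieck_fibration_def)
qed

section \<open>Injective equivalences\<close>

text \<open>Up to isomorphism, the inclusion of a full subgroupoid that meets every component.
  Fullness is expressed through images of objects only; since injectivity on arrows implies
  injectivity on objects, this agrees with fullness for prescribed ends.\<close>

definition injective_equivalence :: "('o, 'a) ftor \<Rightarrow> bool" where
  "injective_equivalence s \<longleftrightarrow> inj_on (far s) (arr (fdom s)) \<and>
     (\<forall>a \<in> arr (fcod s). src (fcod s) a \<in> fob s ` obj (fdom s) \<and> tgt (fcod s) a \<in> fob s `
       obj (fdom s)
        \<longrightarrow> a \<in> far s ` arr (fdom s)) \<and>
     (\<forall>z \<in> obj (fcod s). \<exists>a \<in> arr (fcod s). src (fcod s) a = z \<and> tgt (fcod s) a \<in> fob s `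
       obj (fdom s))"

lemma injective_equivalence_inj_on_fob:
  assumes "is_functor s" "injective_equivalence s"
  shows "inj_on (fob s) (obj (fdom s))"
proof (rule inj_onI)
  fix x y assume *: "x \<in> obj (fdom s)" "y \<in> obj (fdom s)" "fob s x = fob s y"
  interpret is_functor s by fact
  interpret P: category "fdom s" by (rule fdom_category)
  have "inj_on (far s) (arr (fdom s))"
    using assms(2) by (simp add: injective_equivalence_def)
  then have "ident (fdom s) x = ident (fdom s) y"
    by (rule inj_onD) (use * in \<open>simp_all add: far_ident P.category_simps\<close>)
  then show "x = y"
    using * P.src_ident by metis
qed

text \<open>Each object \<open>z\<close> of the codomain of \<open>s\<close> is joined to a point
  \<open>s (\<rho> z)\<close> of the image by \<sigma>. The filler sends \<open>z\<close> to the end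
  of a lifting \<open>L z\<close> of \<open>v (\<sigma> z)\<close> starting at
  \<open>u (\<rho> z)\<close>, and acts on arrows by conjugation with these liftings.\<close>

lemma left_lifting_injective_equivalence:
  assumes s: "s \<in> arr (Gpd \<kappa>)" "injective_equivalence s" and g: "g \<in> normal_cloven_fibrations \<kappa>"
  shows "left_lifting (Gpd \<kappa>) s g"
  unfolding left_lifting_def
proof (intro ballI impI)
  fix u v
  assume "u \<in> hom (Gpd \<kappa>) (src (Gpd \<kappa>) s) (src (Gpd \<kappa>) g)"
    "v \<in> hom (Gpd \<kappa>) (tgt (Gpd \<kappa>) s) (tgt (Gpd \<kappa>) g)"
    and "g \<cdot>\<^bsub>Gpd \<kappa>\<^esub> u = v \<cdot>\<^bsub>Gpd \<kappa>\<^esub> s"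
  then have u: "is_functor u" "fdom u = fdom s" "fcod u = fdom g"
    and v: "is_functor v" "fdom v = fcod s" "fcod v = fcod g"
    and sq: "comp_functor g u = comp_functor v s"
    by (auto simp: hom_Gpd)
  obtain l where l: "cleavage g l" "normal g l"
    using g by (auto simp: normal_cloven_fibrations_def)
  define P Q X Z where PQXZ: "P = fdom s" "Q = fcod s" "X = fdom g" "Z = fcod g"
  interpret s: is_functor s using s by simp
  interpret g: is_functor g using g by (simp add: normal_cloven_fibrations_iff)
  interpret u: is_functor u by fact
  interpret v: is_functor v by fact
  interpret P: groupoid P using s by (auto simp: PQXZ intro: small_groupoid_imp_groupoid)
  interpret Q: groupoid Q using s by (auto simp: PQXZ intro: small_groupoid_imp_groupoid)
  interpret X: groupoid X
    using g by (auto simp: PQXZ normal_cloven_fibrations_iff intro: small_groupoid_imp_groupoid)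
  interpret Z: groupoid Z
    using g by (auto simp: PQXZ normal_cloven_fibrations_iff intro: small_groupoid_imp_groupoid)
  note dc = PQXZ[symmetric] u(2,3) v(2,3)
  note s_simps = s.fob_in[unfolded dc] s.far_in[unfolded dc] s.far_src[unfolded dc]
    s.far_tgt[unfolded dc] s.far_ident[unfolded dc] s.far_cmp[unfolded dc]
  note g_simps = g.fob_in[unfolded dc] g.far_in[unfolded dc] g.far_src[unfolded dc]
    g.far_tgt[unfolded dc] g.far_ident[unfolded dc] g.far_cmp[unfolded dc]
  note u_simps = u.fob_in[unfolded dc] u.far_in[unfolded dc] u.far_src[unfolded dc]
    u.far_tgt[unfolded dc] u.far_ident[unfolded dc] u.far_cmp[unfolded dc]
  note v_simps = v.fob_in[unfolded dc] v.far_in[unfolded dc] v.far_src[unfolded dc]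
    v.far_tgt[unfolded dc] v.far_ident[unfolded dc] v.far_cmp[unfolded dc]
  have sq_ob: "fob g (fob u x) = fob v (fob s x)" if "x \<in> obj P" for x
    using that arg_cong[OF sq, of "\<lambda>F. fob F x"] by (simp add: dc)
  have sq_ar: "far g (far u b) = far v (far s b)" if "b \<in> arr P" for b
    using that arg_cong[OF sq, of "\<lambda>F. far F b"] by (simp add: dc)
  have inj: "inj_on (far s) (arr P)"
    and full: "\<And>a. \<lbrakk>a \<in> arr Q; src Q a \<in> fob s ` obj P; tgt Q a \<in> fob s ` obj P\<rbrakk> \<Longrightarrow>
      a \<in> far s ` arr P"
    and ess: "\<And>z. z \<in> obj Q \<Longrightarrow> \<exists>a \<in> arr Q. src Q a = z \<and> tgt Q a \<in> fob s ` obj P"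
    using s(2) by (auto simp: injective_equivalence_def dc)
  have inj_ob: "inj_on (fob s) (obj P)"
    using injective_equivalence_inj_on_fob[OF s.is_functor_axioms s(2)] by (simp add: dc)

  \<comment> \<open>\<phi> retracts \<open>z\<close> into the image. Choosing the identity on the
    image itself is necessary for the filler to restrict to \<open>u\<close> strictly, rather than
    up to isomorphism.\<close>
  define \<phi> where "\<phi> z = (if z \<in> fob s ` obj P then ident Q z
    else SOME a. a \<in> arr Q \<and> src Q a = z \<and> tgt Q a \<in> fob s ` obj P)" for z
  define \<sigma> where "\<sigma> z = inverse_arrow Q (\<phi> z)" for z
  define \<rho> where "\<rho> z = inv_into (obj P) (fob s) (tgt Q (\<phi> z))" for z
  \<comment> \<open>\<theta> transports an arrow into the image along \<phi> and reads it as an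
    arrow of \<open>P\<close>, which is possible by fullness.\<close>
  define \<theta> where "\<theta> a = inv_into (arr P) (far s) (\<phi> (tgt Q a) \<cdot>\<^bsub>Q\<^esub> a \<cdot>\<^bsub>Q\<^esub> \<sigma> (src Q a))" for a
  define L where "L z = l (fob u (\<rho> z)) (far v (\<sigma> z))" for z
  define h where "h = \<lparr>fdom = Q, fcod = X, fob = (\<lambda>z \<in> obj Q. tgt X (L z)),
    far = (\<lambda>a \<in> arr Q. L (tgt Q a) \<cdot>\<^bsub>X\<^esub> far u (\<theta> a) \<cdot>\<^bsub>X\<^esub> inverse_arrow X (L (src Q a)))\<rparr>"

  have "\<phi> z \<in> arr Q \<and> src Q (\<phi> z) = z \<and> tgt Q (\<phi> z) \<in> fob s ` obj P" if "z \<in> obj Q" for z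
  proof (cases "z \<in> fob s ` obj P")
    case False
    have "\<exists>a. a \<in> arr Q \<and> src Q a = z \<and> tgt Q a \<in> fob s ` obj P"
      using ess[OF that] by blast
    then show ?thesis
      using False by (simp add: \<phi>_def) (rule someI_ex)
  qed (use that in \<open>simp add: \<phi>_def Q.category_simps\<close>)
  then have \<phi>: "\<phi> z \<in> arr Q" "src Q (\<phi> z) = z" "tgt Q (\<phi> z) \<in> fob s ` obj P" if "z \<in> obj Q" for z
    using that by blast+
  have \<rho>: "\<rho> z \<in> obj P" "tgt Q (\<phi> z) = fob s (\<rho> z)" if "z \<in> obj Q" for z
    using \<phi>(3)[OF that] by (simp_all add: \<rho>_def inv_into_into f_inv_into_f)
  have \<sigma>: "\<sigma> z \<in> arr Q" "src Q (\<sigma> z) = fob s (\<rho> z)" "tgt Q (\<sigma> z) = z"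
    "\<sigma> z \<cdot>\<^bsub>Q\<^esub> \<phi> z = ident Q z" "\<phi> z \<cdot>\<^bsub>Q\<^esub> \<sigma> z = ident Q (fob s (\<rho> z))"
    "\<And>k. \<lbrakk>k \<in> arr Q; tgt Q k = z\<rbrakk> \<Longrightarrow> \<sigma> z \<cdot>\<^bsub>Q\<^esub> \<phi> z \<cdot>\<^bsub>Q\<^esub> k = k" if "z \<in> obj Q" for z
    using \<phi>[OF that] \<rho>[OF that] by (simp_all add: \<sigma>_def Q.inverse_arrow Q.inverse_arrow_cmp_cancel)
  have "\<theta> a \<in> arr P \<and> far s (\<theta> a) = \<phi> (tgt Q a) \<cdot>\<^bsub>Q\<^esub> a \<cdot>\<^bsub>Q\<^esub> \<sigma> (src Q a)" if a: "a \<in> arr Q" for a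
  proof -
    have "\<phi> (tgt Q a) \<cdot>\<^bsub>Q\<^esub> a \<cdot>\<^bsub>Q\<^esub> \<sigma> (src Q a) \<in> far s ` arr P"
      by (rule full) (use a in \<open>simp_all add: \<phi> \<rho> \<sigma> Q.category_simps\<close>)
    then show ?thesis
      by (simp add: \<theta>_def inv_into_into f_inv_into_f)
  qed
  then have \<theta>: "\<theta> a \<in> arr P" "far s (\<theta> a) = \<phi> (tgt Q a) \<cdot>\<^bsub>Q\<^esub> a \<cdot>\<^bsub>Q\<^esub> \<sigma> (src Q a)"
    if "a \<in> arr Q" for a
    using that by blast+
  \<comment> \<open>Only the images of the ends under \<open>s\<close> are known directly;
    injectivity on objects recovers the ends.\<close>
  have \<theta>_ends: "src P (\<theta> a) = \<rho> (src Q a)" "tgt P (\<theta> a) = \<rho> (tgt Q a)" if a: "a \<in> arr Q" for a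
  proof -
    show "src P (\<theta> a) = \<rho> (src Q a)"
      by (rule inj_onD[OF inj_ob])
        (use a \<theta>[OF a] s_simps(3)[of "\<theta> a"]
          in \<open>simp_all add: \<phi> \<rho> \<sigma> Q.category_simps P.category_simps\<close>)
    show "tgt P (\<theta> a) = \<rho> (tgt Q a)"
      by (rule inj_onD[OF inj_ob])
        (use a \<theta>[OF a] s_simps(4)[of "\<theta> a"]
          in \<open>simp_all add: \<phi> \<rho> \<sigma> Q.category_simps P.category_simps\<close>)
  qed
  \<comment> \<open>By injectivity on arrows, every later identity about \<theta>, including its
    functoriality, reduces to a computation in \<open>Q\<close>.\<close>
  have \<theta>_unique: "\<theta> a = b"
    if "a \<in> arr Q" "b \<in> arr P" "far s b = \<phi> (tgt Q a) \<cdot>\<^bsub>Q\<^esub> a \<cdot>\<^bsub>Q\<^esub> \<sigma> (src Q a)" for a b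
    by (rule inj_onD[OF inj]) (use that \<theta> in auto)
  have L: "L z \<in> arr X" "src X (L z) = fob u (\<rho> z)" "far g (L z) = far v (\<sigma> z)"
    if z: "z \<in> obj Q" for z
  proof -
    have "is_lifting g (fob u (\<rho> z)) (far v (\<sigma> z)) (L z)"
      using l(1) z by (simp add: cleavage_def dc L_def u_simps v_simps \<rho> \<sigma> sq_ob)
    then show "L z \<in> arr X" "src X (L z) = fob u (\<rho> z)" "far g (L z) = far v (\<sigma> z)"
      by (simp_all add: is_lifting_def dc)
  qed
  \<comment> \<open>On the image all auxiliary arrows are identities. For \<open>L\<close> this is
    where normality of the cleavage enters.\<close>
  have at_s: "\<phi> (fob s x) = ident Q (fob s x)" "\<sigma> (fob s x) = ident Q (fob s x)" "\<rho> (fob s x) = x"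
    "L (fob s x) = ident X (fob u x)" if x: "x \<in> obj P" for x
  proof -
    show \<phi>: "\<phi> (fob s x) = ident Q (fob s x)"
      using x by (simp add: \<phi>_def)
    then show \<sigma>: "\<sigma> (fob s x) = ident Q (fob s x)"
      using x by (simp add: \<sigma>_def Q.inverse_arrow_ident s_simps)
    show \<rho>: "\<rho> (fob s x) = x"
      using x \<phi> inj_ob by (simp add: \<rho>_def Q.category_simps s_simps inv_into_f_f)
    show "L (fob s x) = ident X (fob u x)"
      using x l(2) by (simp add: L_def \<rho> \<sigma> normal_def dc u_simps s_simps v_simps flip: sq_ob)
  qed

  have h_functor: "is_functor h"
  proof (rule is_functorI)
    fix X' assume "X' \<in> obj (fdom h)"
    then have z: "X' \<in> obj Q" by (simp add: h_def)
    show "fob h X' \<in> obj (fcod h)"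
      using z by (simp add: h_def L X.category_simps)
    have "\<theta> (ident Q X') = ident P (\<rho> X')"
      by (rule \<theta>_unique) (use z in \<open>simp_all add: Q.category_simps P.category_simps \<sigma> \<rho> \<phi> s_simps
        Q.ident_cmp[of "\<sigma> X'", unfolded \<sigma>(3)[OF z]]\<close>)
    then show "far h (ident (fdom h) X') = ident (fcod h) (fob h X')"
      using z X.ident_cmp[of "inverse_arrow X (L X')"]
      by (simp add: h_def Q.category_simps u_simps \<rho> L X.inverse_arrow)
  next
    fix a assume "a \<in> arr (fdom h)"
    then have a: "a \<in> arr Q" by (simp add: h_def)
    then show "far h a \<in> hom (fcod h) (fob h (src (fdom h) a)) (fob h (tgt (fdom h) a))"
      by (simp add: h_def hom_def L X.category_simps X.inverse_arrow u_simps \<theta> \<theta>_ends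
        Q.category_simps)
    fix b assume "b \<in> arr (fdom h)" "tgt (fdom h) a = src (fdom h) b"
    then have b: "b \<in> arr Q" "tgt Q a = src Q b" by (simp_all add: h_def)
    \<comment> \<open>The inner factors \<sigma> and \<phi> at the common object cancel. In the
      composite under \<open>h\<close>, the inner \<open>L\<close> and its inverse cancel in the
      same way.\<close>
    have "\<theta> (b \<cdot>\<^bsub>Q\<^esub> a) = \<theta> b \<cdot>\<^bsub>P\<^esub> \<theta> a"
      by (rule \<theta>_unique)
        (use a b in \<open>simp_all add: Q.category_simps P.category_simps \<theta> \<theta>_ends s_simps \<phi> \<rho> \<sigma>\<close>)
    then show "far h (b \<cdot>\<^bsub>fdom h\<^esub> a) = far h b \<cdot>\<^bsub>fcod h\<^esub> far h a"
      using a b by (simp add: h_def Q.category_simps X.category_simps L u_simps \<theta> \<theta>_ends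
        X.inverse_arrow X.inverse_arrow_cmp_cancel)
  qed (use Q.category_axioms X.category_axioms in \<open>simp_all add: h_def\<close>)
  have "comp_functor h s = u"
  proof (rule functor_eqI)
    fix b assume "b \<in> arr (fdom (comp_functor h s))"
    then have b: "b \<in> arr P" by (simp add: dc)
    then have "\<theta> (far s b) = b"
      by (intro \<theta>_unique) (simp_all add: s_simps at_s Q.category_simps P.category_simps
        Q.ident_cmp[of "far s b", unfolded s_simps(4)[OF b]]
        Q.cmp_ident[of "far s b", unfolded s_simps(3)[OF b]])
    then show "far (comp_functor h s) b = far u b"
      using b X.ident_cmp[of "far u b"] X.cmp_ident[of "far u b"]
      by (simp add: dc h_def s_simps at_s P.category_simps X.inverse_arrow_ident u_simps)
  qed (use u h_functor in \<open>simp_all add: dc is_functor_comp s.is_functor_axioms h_def\<close>)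
  moreover have "comp_functor g h = v"
  proof (rule functor_eqI)
    fix a assume "a \<in> arr (fdom (comp_functor g h))"
    then have a: "a \<in> arr Q" by (simp add: h_def)
    let ?z = "src Q a" and ?w = "tgt Q a"
    have zw: "?z \<in> obj Q" "?w \<in> obj Q" using a by (simp_all add: Q.category_simps)
    have v\<sigma>: "far v (\<phi> ?z) = inverse_arrow Z (far v (\<sigma> ?z))"
      by (rule Z.inverse_arrow_unique[symmetric])
        (use zw in \<open>simp_all add: v_simps \<phi> \<sigma> \<rho> s_simps flip: v_simps(6)\<close>)
    have "far (comp_functor g h) a =
      far g (L ?w) \<cdot>\<^bsub>Z\<^esub> far g (far u (\<theta> a)) \<cdot>\<^bsub>Z\<^esub> far g (inverse_arrow X (L ?z))"
      using a zw by (simp add: h_def L X.category_simps X.inverse_arrow u_simps \<theta> \<theta>_ends g_simps)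
    also have "far g (inverse_arrow X (L ?z)) = far v (\<phi> ?z)"
      using zw g.far_inverse_arrow[unfolded dc, OF X.groupoid_axioms Z.groupoid_axioms]
      by (simp add: L v\<sigma>)
    also have "far g (L ?w) \<cdot>\<^bsub>Z\<^esub> far g (far u (\<theta> a)) \<cdot>\<^bsub>Z\<^esub> far v (\<phi> ?z) =
        far v (\<sigma> ?w \<cdot>\<^bsub>Q\<^esub> far s (\<theta> a) \<cdot>\<^bsub>Q\<^esub> \<phi> ?z)"
      using a zw by (simp add: L sq_ar \<theta>(1) v_simps \<sigma> \<phi> \<rho> s_simps \<theta>_ends Q.category_simps)
    \<comment> \<open>Over the base, conjugation by the images of the liftings undoes the
      conjugation in \<theta>.\<close>
    also have "\<sigma> ?w \<cdot>\<^bsub>Q\<^esub> far s (\<theta> a) \<cdot>\<^bsub>Q\<^esub> \<phi> ?z = a"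
      using a zw Q.cmp_ident[OF a] by (simp add: \<theta> Q.category_simps \<sigma> \<phi> \<rho>)
    finally show "far (comp_functor g h) a = far v a" .
  qed (use v h_functor in \<open>simp_all add: dc is_functor_comp g.is_functor_axioms h_def\<close>)
  moreover have "h \<in> hom (Gpd \<kappa>) (tgt (Gpd \<kappa>) s) (src (Gpd \<kappa>) g)"
    using h_functor s g by (simp add: hom_Gpd h_def PQXZ normal_cloven_fibrations_iff)
  ultimately show "\<exists>h \<in> hom (Gpd \<kappa>) (tgt (Gpd \<kappa>) s) (src (Gpd \<kappa>) g).
      h \<cdot>\<^bsub>Gpd \<kappa>\<^esub> s = u \<and> g \<cdot>\<^bsub>Gpd \<kappa>\<^esub> h = v"
    by auto
qed

section \<open>Pullbacks of small groupoids\<close>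

text \<open>A product is finite or as large as its larger factor, so smallness survives pairing for
  every infinite cardinal.\<close>

lemma card_of_Times_ordLess_Cinfinite:
  assumes "Cinfinite \<kappa>" "|A| <o \<kappa>" "|B| <o \<kappa>"
  shows "|A \<times> B| <o \<kappa>"
\<comment> \<open>An empty factor is put with the finite case because the absorption law for
  infinite products needs a nonempty smaller factor.\<close>
proof (cases "finite A \<and> finite B \<or> A = {} \<or> B = {}")
  case True
  then have "finite (A \<times> B)"
    by auto
  then show ?thesis
    using assms(1)
    by (auto intro!: finite_ordLess_infinite
      simp: cinfinite_def card_order_on_well_order_on Field_card_of card_of_well_order_on)
next
  case False
  then have ne: "A \<noteq> {}" "B \<noteq> {}" by auto
  from ordLeq_total[OF card_of_Well_order card_of_Well_order, of A B] show ?thesis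
  proof
    assume le: "|A| \<le>o |B|"
    then have "infinite B"
      using False card_of_ordLeq_finite by blast
    then have "|A \<times> B| =o |B|"
      using ne(1) le by (simp add: card_of_Times_infinite)
    then show ?thesis
      using assms(3) by (rule ordIso_ordLess_trans)
  next
    assume le: "|B| \<le>o |A|"
    then have "infinite A"
      using False card_of_ordLeq_finite by blast
    then have "|A \<times> B| =o |A|"
      using ne(2) le by (simp add: card_of_Times_infinite)
    then show ?thesis
      using assms(2) by (rule ordIso_ordLess_trans)
  qed
qed

lemma small_groupoidI:
  assumes "category A" "|obj A| <o \<kappa>" "|arr A| <o \<kappa>"
    and "src A \<in> extensional (arr A)" "tgt A \<in> extensional (arr A)" "ident A \<in> extensional (obj A)"
    and "\<And>f g. \<not> (f \<in> arr A \<and> g \<in> arr A \<and> tgt A f = src A g) \<Longrightarrow> g \<cdot>\<^bsub>A\<^esub> f = undefined"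
    and "\<And>f. f \<in> arr A \<Longrightarrow> \<exists>g \<in> arr A. src A g = tgt A f \<and> tgt A g = src A f \<and>
      g \<cdot>\<^bsub>A\<^esub> f = ident A (src A f) \<and> f \<cdot>\<^bsub>A\<^esub> g = ident A (tgt A f)"
  shows "small_groupoid \<kappa> A"
proof -
  interpret category A by fact
  have "isomorphism A f" if "f \<in> arr A" for f
    using assms(8)[OF that] that by (auto simp: isomorphism_def hom_def)
  then have "groupoid A"
    by unfold_locales
  then show ?thesis
    using assms(2-7) by (simp add: small_groupoid_def)
qed

lemma terminal_Gpd_exists:
  assumes "Cinfinite (\<kappa> :: 'u rel)"
  shows "\<exists>T. terminal (Gpd \<kappa>) T"
proof -
  \<comment> \<open>Taking \<open>undefined\<close> as the only object and arrow makes the constant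
    operations extensional without any restriction.\<close>
  define T :: "('u, 'u) cat" where "T = \<lparr>obj = {undefined}, arr = {undefined},
    src = (\<lambda>_. undefined),
    tgt = (\<lambda>_. undefined), ident = (\<lambda>_. undefined), cmp = (\<lambda>_ _. undefined)\<rparr>"
  have fin: "|{undefined :: 'u}| <o \<kappa>"
    using assms
      by (auto intro!: finite_ordLess_infinite
        simp: cinfinite_def card_order_on_well_order_on Field_card_of card_of_well_order_on)
  have T: "small_groupoid \<kappa> T"
    by (rule small_groupoidI) (unfold_locales, auto simp: T_def fin)
  have "\<exists>!h. h \<in> hom (Gpd \<kappa>) A T" if A: "small_groupoid \<kappa> A" for A
  proof (rule ex1I)
    show "const_functor A T undefined \<in> hom (Gpd \<kappa>) A T"
      using A T small_groupoid_imp_category[OF A] small_groupoid_imp_category[OF T]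
      by (auto simp: hom_Gpd is_functor_const T_def) (simp_all add: const_functor_def)
    fix h assume h: "h \<in> hom (Gpd \<kappa>) A T"
    show "h = const_functor A T undefined"
    proof (rule functor_eqI)
      show "far h a = far (const_functor A T undefined) a" if "a \<in> arr (fdom h)" for a
        using is_functor.far_in[of h a] h that by (simp add: hom_Gpd const_functor_def T_def)
      show "is_functor (const_functor A T undefined)"
        using small_groupoid_imp_category[OF A] small_groupoid_imp_category[OF T]
        by (rule is_functor_const) (simp add: T_def)
    qed (use h in \<open>simp_all add: hom_Gpd const_functor_def\<close>)
  qed
  then show ?thesis
    using T by (auto simp: terminal_def)
qed

section \<open>Coded pairs and the strict fibre product\<close>

text \<open>A surjective pairing on all of \<open>'u\<close>, so that sets of pairs and of triples
  can again be carriers of groupoids in \<open>Gpd \<kappa>\<close>.\<close>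

locale pair_code =
  fixes \<kappa> :: "'u rel" and pair :: "'u \<Rightarrow> 'u \<Rightarrow> 'u" and d0 d1 :: "'u \<Rightarrow> 'u"
  assumes Cinfinite: "Cinfinite \<kappa>"
    and d0_pair [simp]: "d0 (pair x y) = x"
    and d1_pair [simp]: "d1 (pair x y) = y"
    and pair_d0_d1 [simp]: "pair (d0 z) (d1 z) = z"
begin

text \<open>As simplification rules this and its mirror image turn equations of codes into equations
  of components. They are disabled where a code has to survive as a term.\<close>

lemma pair_eq_iff [simp]: "pair x y = z \<longleftrightarrow> x = d0 z \<and> y = d1 z"
  by (metis d0_pair d1_pair pair_d0_d1)

lemma eq_pair_iff [simp]: "z = pair x y \<longleftrightarrow> d0 z = x \<and> d1 z = y"
  by (metis d0_pair d1_pair pair_d0_d1)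

lemma card_of_coded_pairs:
  assumes "A \<subseteq> {z. d0 z \<in> S \<and> d1 z \<in> T}" "|S| <o \<kappa>" "|T| <o \<kappa>"
  shows "|A| <o \<kappa>"
proof -
  have "A \<subseteq> (\<lambda>(x, y). pair x y) ` (S \<times> T)"
  proof
    fix z assume "z \<in> A"
    then have "(d0 z, d1 z) \<in> S \<times> T" "z = (\<lambda>(x, y). pair x y) (d0 z, d1 z)"
      using assms(1) by auto
    then show "z \<in> (\<lambda>(x, y). pair x y) ` (S \<times> T)"
      by blast
  qed
  then have "|A| \<le>o |S \<times> T|"
    using card_of_mono1 card_of_image ordLeq_transitive by blast
  then show ?thesis
    using card_of_Times_ordLess_Cinfinite[OF Cinfinite assms(2,3)] ordLeq_ordLess_trans by blast
qed

text \<open>Source and target are bound beforehand because the guard of the composition refers to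
  them. The restrictions and the guard supply the values \<open>undefined\<close> that
  \<open>small_groupoid\<close> prescribes.\<close>

definition fibre_product :: "('u, 'u) ftor \<Rightarrow> ('u, 'u) ftor \<Rightarrow> ('u, 'u) cat" where
  "fibre_product f g =
     (let B = {z. d0 z \<in> obj (fdom f) \<and> d1 z \<in> obj (fdom g) \<and> fob f (d0 z) = fob g (d1 z)};
          A = {c. d0 c \<in> arr (fdom f) \<and> d1 c \<in> arr (fdom g) \<and> far f (d0 c) = far g (d1 c)};
          s = (\<lambda>c \<in> A. pair (src (fdom f) (d0 c)) (src (fdom g) (d1 c)));
          t = (\<lambda>c \<in> A. pair (tgt (fdom f) (d0 c)) (tgt (fdom g) (d1 c)))
      in \<lparr>obj = B, arr = A, src = s, tgt = t,
          ident = (\<lambda>z \<in> B. pair (ident (fdom f) (d0 z)) (ident (fdom g) (d1 z))),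
          cmp = (\<lambda>b a. if a \<in> A \<and> b \<in> A \<and> t a = s b
            then pair (d0 b \<cdot>\<^bsub>fdom f\<^esub> d0 a) (d1 b \<cdot>\<^bsub>fdom g\<^esub> d1 a) else undefined)\<rparr>)"

lemma fibre_product_simps:
  "z \<in> obj (fibre_product f g) \<longleftrightarrow>
     d0 z \<in> obj (fdom f) \<and> d1 z \<in> obj (fdom g) \<and> fob f (d0 z) = fob g (d1 z)"
  "c \<in> arr (fibre_product f g) \<longleftrightarrow>
     d0 c \<in> arr (fdom f) \<and> d1 c \<in> arr (fdom g) \<and> far f (d0 c) = far g (d1 c)"
  "c \<in> arr (fibre_product f g) \<Longrightarrow>
     src (fibre_product f g) c = pair (src (fdom f) (d0 c)) (src (fdom g) (d1 c))"
  "c \<in> arr (fibre_product f g) \<Longrightarrow>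
     tgt (fibre_product f g) c = pair (tgt (fdom f) (d0 c)) (tgt (fdom g) (d1 c))"
  "z \<in> obj (fibre_product f g) \<Longrightarrow>
     ident (fibre_product f g) z = pair (ident (fdom f) (d0 z)) (ident (fdom g) (d1 z))"
  "\<lbrakk>a \<in> arr (fibre_product f g); b \<in> arr (fibre_product f g);
     tgt (fibre_product f g) a = src (fibre_product f g) b\<rbrakk> \<Longrightarrow>
     b \<cdot>\<^bsub>fibre_product f g\<^esub> a = pair (d0 b \<cdot>\<^bsub>fdom f\<^esub> d0 a) (d1 b \<cdot>\<^bsub>fdom g\<^esub> d1 a)"
  by (simp_all add: fibre_product_def Let_def del: pair_eq_iff eq_pair_iff)

definition fp0 :: "('u, 'u) ftor \<Rightarrow> ('u, 'u) ftor \<Rightarrow> ('u, 'u) ftor" where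
  "fp0 f g = \<lparr>fdom = fibre_product f g, fcod = fdom f,
     fob = restrict d0 (obj (fibre_product f g)), far = restrict d0 (arr (fibre_product f g))\<rparr>"

definition fp1 :: "('u, 'u) ftor \<Rightarrow> ('u, 'u) ftor \<Rightarrow> ('u, 'u) ftor" where
  "fp1 f g = \<lparr>fdom = fibre_product f g, fcod = fdom g,
     fob = restrict d1 (obj (fibre_product f g)), far = restrict d1 (arr (fibre_product f g))\<rparr>"

definition fp_pair
  :: "('u, 'u) ftor \<Rightarrow> ('u, 'u) ftor \<Rightarrow> ('u, 'u) ftor \<Rightarrow> ('u, 'u) ftor \<Rightarrow> ('u, 'u) ftor" where
  "fp_pair f g u v = \<lparr>fdom = fdom u, fcod = fibre_product f g,
     fob = (\<lambda>x \<in> obj (fdom u). pair (fob u x) (fob v x)),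
     far = (\<lambda>a \<in> arr (fdom u). pair (far u a) (far v a))\<rparr>"

context
  fixes f g :: "('u, 'u) ftor"
  assumes f: "f \<in> arr (Gpd \<kappa>)" and g: "g \<in> arr (Gpd \<kappa>)" and fg: "fcod f = fcod g"
begin

interpretation f: is_functor f using f by simp
interpretation g: is_functor g using g by simp
interpretation X: groupoid "fdom f" using f by (auto intro: small_groupoid_imp_groupoid)
interpretation Y: groupoid "fdom g" using g by (auto intro: small_groupoid_imp_groupoid)
interpretation Z: groupoid "fcod g" using g by (auto intro: small_groupoid_imp_groupoid)

lemmas functor_simps = f.far_src f.far_tgt f.far_ident f.far_cmp f.fob_in f.far_in
  g.far_src g.far_tgt g.far_ident g.far_cmp g.fob_in g.far_in

lemma category_fibre_product: "category (fibre_product f g)"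
proof -
  have src: "fob f (src (fdom f) (d0 c)) = fob g (src (fdom g) (d1 c))"
    and tgt: "fob f (tgt (fdom f) (d0 c)) = fob g (tgt (fdom g) (d1 c))"
    if "c \<in> arr (fibre_product f g)" for c
    using that f.far_src[of "d0 c"] g.far_src[of "d1 c"] f.far_tgt[of "d0 c"] g.far_tgt[of "d1 c"]
    by (simp_all add: fibre_product_simps fg)
  have cmp: "b \<cdot>\<^bsub>fibre_product f g\<^esub> a \<in> arr (fibre_product f g)"
    if "a \<in> arr (fibre_product f g)" "b \<in> arr (fibre_product f g)"
      "tgt (fibre_product f g) a = src (fibre_product f g) b" for a b
    using that by (simp add: fibre_product_simps X.category_simps Y.category_simps functor_simps fg)
  have ident: "ident (fibre_product f g) z \<in> arr (fibre_product f g)"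
    if "z \<in> obj (fibre_product f g)" for z
    using that by (simp add: fibre_product_simps X.category_simps Y.category_simps functor_simps fg)
  show ?thesis
  proof
    fix c assume c: "c \<in> arr (fibre_product f g)"
    show sc: "src (fibre_product f g) c \<in> obj (fibre_product f g)"
      and tc: "tgt (fibre_product f g) c \<in> obj (fibre_product f g)"
      using c src[OF c] tgt[OF c]
        by (auto simp: fibre_product_simps X.category_simps Y.category_simps)
    show "c \<cdot>\<^bsub>fibre_product f g\<^esub> ident (fibre_product f g) (src (fibre_product f g) c) = c"
      using c ident[OF sc] sc
      by (simp add: fibre_product_simps X.category_simps Y.category_simps)
    show "ident (fibre_product f g) (tgt (fibre_product f g) c) \<cdot>\<^bsub>fibre_product f g\<^esub> c = c"
      using c ident[OF tc] tc
      by (simp add: fibre_product_simps X.category_simps Y.category_simps)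
    fix a b assume ab: "a \<in> arr (fibre_product f g)" "b \<in> arr (fibre_product f g)"
      "tgt (fibre_product f g) c = src (fibre_product f g) a"
      "tgt (fibre_product f g) a = src (fibre_product f g) b"
    have t: "tgt (fibre_product f g) (a \<cdot>\<^bsub>fibre_product f g\<^esub> c) = src (fibre_product f g) b"
      "src (fibre_product f g) (b \<cdot>\<^bsub>fibre_product f g\<^esub> a) = tgt (fibre_product f g) c"
      using cmp[OF c ab(1,3)] cmp[OF ab(1,2,4)] ab c
      by (simp_all add: fibre_product_simps X.category_simps Y.category_simps)
    show "(b \<cdot>\<^bsub>fibre_product f g\<^esub> a) \<cdot>\<^bsub>fibre_product f g\<^esub> c =
        b \<cdot>\<^bsub>fibre_product f g\<^esub> a \<cdot>\<^bsub>fibre_product f g\<^esub> c"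
      using ab c cmp[OF c ab(1,3)] cmp[OF ab(1,2,4)] t
      by (simp add: fibre_product_simps X.category_simps Y.category_simps)
  next
    fix a b assume ab: "a \<in> arr (fibre_product f g)" "b \<in> arr (fibre_product f g)"
      "tgt (fibre_product f g) a = src (fibre_product f g) b"
    show "src (fibre_product f g) (b \<cdot>\<^bsub>fibre_product f g\<^esub> a) = src (fibre_product f g) a"
      "tgt (fibre_product f g) (b \<cdot>\<^bsub>fibre_product f g\<^esub> a) = tgt (fibre_product f g) b"
      using cmp[OF ab] ab by (simp_all add: fibre_product_simps X.category_simps Y.category_simps)
    show "b \<cdot>\<^bsub>fibre_product f g\<^esub> a \<in> arr (fibre_product f g)"
      by (rule cmp[OF ab])
  next
    fix z assume z: "z \<in> obj (fibre_product f g)"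
    show "src (fibre_product f g) (ident (fibre_product f g) z) = z"
      "tgt (fibre_product f g) (ident (fibre_product f g) z) = z"
      using ident[OF z] z by (simp_all add: fibre_product_simps X.category_simps Y.category_simps)
    show "ident (fibre_product f g) z \<in> arr (fibre_product f g)"
      by (rule ident[OF z])
  qed
qed

text \<open>Inverses are formed componentwise and stay in the fibre product because functors
  preserve inverses.\<close>

lemma small_groupoid_fibre_product: "small_groupoid \<kappa> (fibre_product f g)"
proof (rule small_groupoidI)
  show "|obj (fibre_product f g)| <o \<kappa>"
    by (rule card_of_coded_pairs[of _ "obj (fdom f)" "obj (fdom g)"])
      (use f g in \<open>auto simp: fibre_product_simps small_groupoid_def\<close>)
  show "|arr (fibre_product f g)| <o \<kappa>"
    by (rule card_of_coded_pairs[of _ "arr (fdom f)" "arr (fdom g)"])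
      (use f g in \<open>auto simp: fibre_product_simps small_groupoid_def\<close>)
  fix c assume c: "c \<in> arr (fibre_product f g)"
  let ?b = "pair (inverse_arrow (fdom f) (d0 c)) (inverse_arrow (fdom g) (d1 c))"
  interpret category "fibre_product f g" by (rule category_fibre_product)
  have "?b \<in> arr (fibre_product f g)"
    using c f.far_inverse_arrow[of "d0 c"] g.far_inverse_arrow[of "d1 c"]
      X.groupoid_axioms Y.groupoid_axioms Z.groupoid_axioms
    by (simp add: fibre_product_simps X.inverse_arrow Y.inverse_arrow fg)
  then show "\<exists>b \<in> arr (fibre_product f g). src (fibre_product f g) b = tgt (fibre_product f g) c \<and>
      tgt (fibre_product f g) b = src (fibre_product f g) c \<and>
      b \<cdot>\<^bsub>fibre_product f g\<^esub> c = ident (fibre_product f g) (src (fibre_product f g) c) \<and>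
      c \<cdot>\<^bsub>fibre_product f g\<^esub> b = ident (fibre_product f g) (tgt (fibre_product f g) c)"
    using c src_closed[OF c] tgt_closed[OF c]
    by (intro bexI[of _ ?b]) (simp_all add: fibre_product_simps X.inverse_arrow Y.inverse_arrow)
qed (use category_fibre_product in \<open>auto simp: fibre_product_def Let_def extensional_def\<close>)

lemma is_functor_fp0: "is_functor (fp0 f g)"
  and is_functor_fp1: "is_functor (fp1 f g)"
proof -
  interpret P: category "fibre_product f g" by (rule category_fibre_product)
  show "is_functor (fp0 f g)"
  proof (rule is_functorI)
    fix a assume "a \<in> arr (fdom (fp0 f g))"
    then show "far (fp0 f g) a \<in> hom (fcod (fp0 f g)) (fob (fp0 f g) (src (fdom (fp0 f g)) a))
        (fob (fp0 f g) (tgt (fdom (fp0 f g)) a))"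
      using P.src_closed[of a] P.tgt_closed[of a]
        by (auto simp: fp0_def hom_def fibre_product_simps)
  qed (auto simp: fp0_def P.category_axioms X.category_axioms P.category_simps, auto
    simp: fibre_product_simps)
  show "is_functor (fp1 f g)"
  proof (rule is_functorI)
    fix a assume "a \<in> arr (fdom (fp1 f g))"
    then show "far (fp1 f g) a \<in> hom (fcod (fp1 f g)) (fob (fp1 f g) (src (fdom (fp1 f g)) a))
        (fob (fp1 f g) (tgt (fdom (fp1 f g)) a))"
      using P.src_closed[of a] P.tgt_closed[of a]
        by (auto simp: fp1_def hom_def fibre_product_simps)
  qed (auto simp: fp1_def P.category_axioms Y.category_axioms P.category_simps, auto
    simp: fibre_product_simps)
qed

lemma is_functor_fp_pair:
  assumes "is_functor u" "is_functor v" "fdom v = fdom u" "fcod u = fdom f" "fcod v = fdom g"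
    and eq: "comp_functor f u = comp_functor g v"
  shows "is_functor (fp_pair f g u v)"
proof -
  interpret u: is_functor u by fact
  interpret v: is_functor v by fact
  interpret W: category "fdom u" by (rule u.fdom_category)
  note v_simps = v.fob_in[unfolded assms(3,5)] v.far_in[unfolded assms(3,5)]
    v.far_src[unfolded assms(3,5)]
    v.far_tgt[unfolded assms(3,5)] v.far_ident[unfolded assms(3,5)] v.far_cmp[unfolded assms(3,5)]
  note u_simps = u.fob_in[unfolded assms(4)] u.far_in[unfolded assms(4)]
    u.far_src[unfolded assms(4)]
    u.far_tgt[unfolded assms(4)] u.far_ident[unfolded assms(4)] u.far_cmp[unfolded assms(4)]
  have ob: "fob f (fob u x) = fob g (fob v x)" if "x \<in> obj (fdom u)" for x
    using that arg_cong[OF eq, of "\<lambda>F. fob F x"] assms(3) by simp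
  have ar: "far f (far u b) = far g (far v b)" if "b \<in> arr (fdom u)" for b
    using that arg_cong[OF eq, of "\<lambda>F. far F b"] assms(3) by simp
  have o: "pair (fob u x) (fob v x) \<in> obj (fibre_product f g)" if "x \<in> obj (fdom u)" for x
    using that by (simp add: fibre_product_simps ob u_simps v_simps)
  have a: "pair (far u b) (far v b) \<in> arr (fibre_product f g)" if "b \<in> arr (fdom u)" for b
    using that by (simp add: fibre_product_simps ar u_simps v_simps)
  show ?thesis
    by (rule is_functorI)
      (auto simp: fp_pair_def o a u.fdom_category category_fibre_product W.category_simps hom_def
        fibre_product_simps(3-) u_simps v_simps)
qed

text \<open>The mediating functor is \<open>fp_pair\<close>; it is the only one because a code is
  determined by its two components.\<close>

lemma is_pullback_fibre_product: "is_pullback (Gpd \<kappa>) f g (fp0 f g) (fp1 f g)"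
proof -
  have dc: "fdom (fp0 f g) = fibre_product f g" "fdom (fp1 f g) = fibre_product f g"
    "fcod (fp0 f g) = fdom f" "fcod (fp1 f g) = fdom g"
    by (simp_all add: fp0_def fp1_def)
  have eq: "comp_functor f (fp0 f g) = comp_functor g (fp1 f g)"
  proof (rule functor_eqI)
    fix a assume "a \<in> arr (fdom (comp_functor f (fp0 f g)))"
    then show "far (comp_functor f (fp0 f g)) a = far (comp_functor g (fp1 f g)) a"
      by (simp add: dc) (simp add: fp0_def fp1_def fibre_product_simps)
  qed (use f g fg in \<open>auto intro!: is_functor_comp is_functor_fp0 is_functor_fp1 simp: dc\<close>)
  have "\<exists>!h. h \<in> hom (Gpd \<kappa>) (fdom u) (fibre_product f g) \<and> comp_functor (fp0 f g) h = u \<and>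
    comp_functor (fp1 f g) h = v"
    if u: "u \<in> arr (Gpd \<kappa>)" and v: "v \<in> arr (Gpd \<kappa>)"
      and uv: "fdom u = fdom v" "fcod u = fdom f" "fcod v = fdom g"
      and eq: "comp_functor f u = comp_functor g v" for u v
  proof (rule ex1I)
    have pair: "is_functor (fp_pair f g u v)"
      by (rule is_functor_fp_pair) (use u v uv eq in auto)
    have "comp_functor (fp0 f g) (fp_pair f g u v) = u"
    proof (rule functor_eqI)
      show "is_functor (comp_functor (fp0 f g) (fp_pair f g u v))"
        by (rule is_functor_comp) (auto simp: pair is_functor_fp0, simp add: fp_pair_def fp0_def)
      fix a assume "a \<in> arr (fdom (comp_functor (fp0 f g) (fp_pair f g u v)))"
      then show "far (comp_functor (fp0 f g) (fp_pair f g u v)) a = far u a"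
        using is_functor.far_in[OF pair, of a] by (simp add: fp0_def fp_pair_def)
    qed (use u uv in \<open>auto simp: fp0_def fp_pair_def\<close>)
    moreover have "comp_functor (fp1 f g) (fp_pair f g u v) = v"
    proof (rule functor_eqI)
      show "is_functor (comp_functor (fp1 f g) (fp_pair f g u v))"
        by (rule is_functor_comp) (auto simp: pair is_functor_fp1, simp add: fp_pair_def fp1_def)
      fix a assume "a \<in> arr (fdom (comp_functor (fp1 f g) (fp_pair f g u v)))"
      then show "far (comp_functor (fp1 f g) (fp_pair f g u v)) a = far v a"
        using is_functor.far_in[OF pair, of a] by (simp add: fp1_def fp_pair_def)
    qed (use v uv in \<open>auto simp: fp1_def fp_pair_def\<close>)
    moreover have "fp_pair f g u v \<in> hom (Gpd \<kappa>) (fdom u) (fibre_product f g)"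
      using pair u small_groupoid_fibre_product by (simp add: hom_Gpd fp_pair_def)
    ultimately show "fp_pair f g u v \<in> hom (Gpd \<kappa>) (fdom u) (fibre_product f g) \<and>
        comp_functor (fp0 f g) (fp_pair f g u v) = u \<and> comp_functor (fp1 f g) (fp_pair f g u v) = v"
      by blast
    fix h assume h: "h \<in> hom (Gpd \<kappa>) (fdom u) (fibre_product f g) \<and> comp_functor (fp0 f g) h = u \<and>
      comp_functor (fp1 f g) h = v"
    then have hd: "is_functor h" "fdom h = fdom u" "fcod h = fibre_product f g"
      by (simp_all add: hom_Gpd)
    interpret h: is_functor h by (rule hd)
    show "h = fp_pair f g u v"
    proof (rule functor_eqI)
      fix a assume a: "a \<in> arr (fdom h)"
      then have "far (comp_functor (fp0 f g) h) a = d0 (far h a)"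
        "far (comp_functor (fp1 f g) h) a = d1 (far h a)"
        using h.far_in[OF a] hd(3) by (simp_all add: fp0_def fp1_def)
      then have "far u a = d0 (far h a)" "far v a = d1 (far h a)"
        using h by simp_all
      then show "far h a = far (fp_pair f g u v) a"
        using a hd(2) by (simp add: fp_pair_def)
    qed (use hd pair in \<open>simp_all add: fp_pair_def\<close>)
  qed
  then show ?thesis
    using f g fg eq dc
      by (simp add: is_pullback_def is_functor_fp0 is_functor_fp1 small_groupoid_fibre_product)
qed

end

section \<open>Base change along arbitrary pullbacks\<close>

text \<open>Evident for the coded fibre product, and transported along the comparison isomorphism,
  which is bijective on objects and on arrows. This is the strictness that
  \<open>pullback_cleavage\<close> asks for.\<close>

lemma is_pullback_strict:
  assumes pb: "is_pullback (Gpd \<kappa>) f g p q"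
  shows "bij_betw (\<lambda>z. (fob p z, fob q z)) (obj (fdom p))
          {(x, e). x \<in> obj (fdom f) \<and> e \<in> obj (fdom g) \<and> fob f x = fob g e}"
    and "bij_betw (\<lambda>b. (far p b, far q b)) (arr (fdom p))
          {(a, b). a \<in> arr (fdom f) \<and> b \<in> arr (fdom g) \<and> far f a = far g b}"
proof -
  have fg: "f \<in> arr (Gpd \<kappa>)" "g \<in> arr (Gpd \<kappa>)" "fcod f = fcod g"
    using pb by (auto simp: is_pullback_def)
  obtain h where h: "isomorphism (Gpd \<kappa>) h" "fdom h = fdom p" "fcod h = fibre_product f g"
    "comp_functor (fp0 f g) h = p" "comp_functor (fp1 f g) h = q"
    using category.pullback_comparison[OF category_Gpd pb is_pullback_fibre_product[OF fg]]
    by (auto simp: fp0_def)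
  interpret h: is_functor h using h by (simp add: isomorphism_def)
  have ob: "bij_betw (\<lambda>z. (d0 z, d1 z)) (obj (fibre_product f g))
      {(x, e). x \<in> obj (fdom f) \<and> e \<in> obj (fdom g) \<and> fob f x = fob g e}"
    by (rule bij_betw_byWitness[of _ "\<lambda>(x, e). pair x e"]) (auto simp: fibre_product_simps)
  have ar: "bij_betw (\<lambda>z. (d0 z, d1 z)) (arr (fibre_product f g))
      {(a, b). a \<in> arr (fdom f) \<and> b \<in> arr (fdom g) \<and> far f a = far g b}"
    by (rule bij_betw_byWitness[of _ "\<lambda>(x, e). pair x e"]) (auto simp: fibre_product_simps)
  have "d0 (fob h z) = fob p z \<and> d1 (fob h z) = fob q z" if "z \<in> obj (fdom p)" for z
    unfolding h(4,5)[symmetric] using that h(2,3) h.fob_in[of z] by (simp add: fp0_def fp1_def)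
  then show "bij_betw (\<lambda>z. (fob p z, fob q z)) (obj (fdom p))
          {(x, e). x \<in> obj (fdom f) \<and> e \<in> obj (fdom g) \<and> fob f x = fob g e}"
    using bij_betw_trans[OF isomorphism_Gpd_bij(1)[OF h(1)], unfolded h(2,3), OF ob]
    by (subst bij_betw_cong) auto
  have "d0 (far h z) = far p z \<and> d1 (far h z) = far q z" if "z \<in> arr (fdom p)" for z
    unfolding h(4,5)[symmetric] using that h(2,3) h.far_in[of z] by (simp add: fp0_def fp1_def)
  then show "bij_betw (\<lambda>b. (far p b, far q b)) (arr (fdom p))
          {(a, b). a \<in> arr (fdom f) \<and> b \<in> arr (fdom g) \<and> far f a = far g b}"
    using bij_betw_trans[OF isomorphism_Gpd_bij(2)[OF h(1)], unfolded h(2,3), OF ar]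
    by (subst bij_betw_cong) auto
qed

lemma is_pullback_ob_eq:
  assumes pb: "is_pullback (Gpd \<kappa>) f g p q" and z: "z \<in> obj (fdom p)"
  shows "fob f (fob p z) = fob g (fob q z)"
  using bij_betwE[OF is_pullback_strict(1)[OF pb]] z by auto

lemma normal_cloven_fibrations_base_change:
  assumes pb: "is_pullback (Gpd \<kappa>) f g p q" and g: "g \<in> normal_cloven_fibrations \<kappa>"
  shows "p \<in> normal_cloven_fibrations \<kappa>"
proof -
  obtain l where l: "cleavage g l"
    using g by (auto simp: normal_cloven_fibrations_def)
  have "cleavage p (pullback_cleavage f p q l)"
    by (rule pullback_cleavage(1)[OF _ _ _ _ _ _ _ _ is_pullback_ob_eq[OF pb]
      is_pullback_strict[OF pb] l])
      (use pb in \<open>auto simp: is_pullback_def\<close>)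
  then show ?thesis
    using pb by (auto
      simp: normal_cloven_fibrations_iff is_pullback_def intro: cleavage_imp_Grothendieck_fibration)
qed

text \<open>Injectivity and fullness follow componentwise from strictness. That every object is
  joined to the image is where \<open>q\<close> has to be an isofibration: the arrow that
  \<open>r\<close> provides in the base must be lifted.\<close>

lemma injective_equivalence_base_change:
  assumes pb: "is_pullback (Gpd \<kappa>) q r s t" and q: "q \<in> normal_cloven_fibrations \<kappa>"
    and r: "injective_equivalence r"
  shows "injective_equivalence s"
proof -
  have F: "is_functor q" "is_functor r" "is_functor s" "is_functor t"
    and dc: "fcod q = fcod r" "fdom t = fdom s" "fcod s = fdom q" "fcod t = fdom r"
    using pb by (auto simp: is_pullback_def)
  interpret q: is_functor q by fact
  interpret r: is_functor r by fact
  interpret s: is_functor s by fact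
  interpret t: is_functor t by fact
  have inj: "inj_on (\<lambda>b. (far s b, far t b)) (arr (fdom s))"
    using is_pullback_strict(2)[OF pb] by (rule bij_betw_imp_inj_on)
  have ex_ob: "\<exists>w \<in> obj (fdom s). fob s w = x \<and> fob t w = e"
    if "x \<in> obj (fdom q)" "e \<in> obj (fdom r)" "fob q x = fob r e" for x e
  proof -
    have "(x, e) \<in> (\<lambda>z. (fob s z, fob t z)) ` obj (fdom s)"
      using that bij_betw_imp_surj_on[OF is_pullback_strict(1)[OF pb]] by simp
    then show ?thesis by auto
  qed
  have ex_ar: "\<exists>c \<in> arr (fdom s). far s c = a \<and> far t c = b"
    if "a \<in> arr (fdom q)" "b \<in> arr (fdom r)" "far q a = far r b" for a b
  proof -
    have "(a, b) \<in> (\<lambda>z. (far s z, far t z)) ` arr (fdom s)"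
      using that bij_betw_imp_surj_on[OF is_pullback_strict(2)[OF pb]] by simp
    then show ?thesis by auto
  qed
  have eq: "far q (far s b) = far r (far t b)" if "b \<in> arr (fdom s)" for b
    using bij_betwE[OF is_pullback_strict(2)[OF pb]] that by auto
  have eq_ob: "fob q (fob s b) = fob r (fob t b)" if "b \<in> obj (fdom s)" for b
    using is_pullback_ob_eq[OF pb that] .
  have t_ob: "fob t w \<in> obj (fdom r)" if "w \<in> obj (fdom s)" for w
    using t.fob_in that dc by auto
  have t_ar: "far t b \<in> arr (fdom r)" if "b \<in> arr (fdom s)" for b
    using t.far_in that dc by auto
  have r_inj: "inj_on (far r) (arr (fdom r))"
    and r_full: "\<And>a. \<lbrakk>a \<in> arr (fcod r); src (fcod r) a \<in> fob r ` obj (fdom r);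
      tgt (fcod r) a \<in> fob r ` obj (fdom r)\<rbrakk> \<Longrightarrow> a \<in> far r ` arr (fdom r)"
    and r_ess: "\<And>z. z \<in> obj (fcod r) \<Longrightarrow>
      \<exists>a \<in> arr (fcod r). src (fcod r) a = z \<and> tgt (fcod r) a \<in> fob r ` obj (fdom r)"
    using r by (auto simp: injective_equivalence_def)
  show ?thesis
    unfolding injective_equivalence_def
  proof (intro conjI ballI impI)
    show "inj_on (far s) (arr (fdom s))"
    proof (rule inj_onI)
      fix b c assume bc: "b \<in> arr (fdom s)" "c \<in> arr (fdom s)" "far s b = far s c"
      then have "far r (far t b) = far r (far t c)"
        by (simp flip: eq)
      then have "far t b = far t c"
        using r_inj bc t_ar by (auto dest: inj_onD)
      then show "b = c"
        using bc inj by (auto dest: inj_onD)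
    qed
  next
    fix a assume a: "a \<in> arr (fcod s)"
      and "src (fcod s) a \<in> fob s ` obj (fdom s) \<and> tgt (fcod s) a \<in> fob s ` obj (fdom s)"
    then obtain x y where xy: "x \<in> obj (fdom s)" "y \<in> obj (fdom s)"
      "src (fcod s) a = fob s x" "tgt (fcod s) a = fob s y"
      by auto
    have "far q a \<in> far r ` arr (fdom r)"
      by (rule r_full)
        (use a xy q.far_in[of a] q.far_src[of a] q.far_tgt[of a] t_ob in \<open>simp_all add: dc eq_ob\<close>)
    then obtain b where "b \<in> arr (fdom r)" "far q a = far r b"
      by auto
    then show "a \<in> far s ` arr (fdom s)"
      using ex_ar[of a b] a dc by auto
  next
    fix z assume z: "z \<in> obj (fcod s)"
    obtain a e where a: "a \<in> arr (fcod r)" "src (fcod r) a = fob q z"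
      "e \<in> obj (fdom r)" "tgt (fcod r) a = fob r e"
      using r_ess[of "fob q z"] q.fob_in[of z] z dc by auto
    \<comment> \<open>The target of the lifting lies over an object in the image of
      \<open>r\<close>, and together with \<open>e\<close> it forms an object of the
      pullback.\<close>
    then obtain b where b: "is_lifting q z a b"
      using q z dc unfolding normal_cloven_fibrations_iff Grothendieck_fibration_def by metis
    then have "fob q (tgt (fdom q) b) = fob r e"
      using q.far_tgt[of b] a dc by (simp add: is_lifting_def)
    then obtain w where w: "w \<in> obj (fdom s)" "fob s w = tgt (fdom q) b"
      using ex_ob[of "tgt (fdom q) b" e] a b category.tgt_closed[OF q.fdom_category, of b]
      by (auto simp: is_lifting_def)
    then have "tgt (fdom q) b \<in> fob s ` obj (fdom s)"
      by (metis image_eqI)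
    then show "\<exists>a \<in> arr (fcod s). src (fcod s) a = z \<and> tgt (fcod s) a \<in> fob s ` obj (fdom s)"
      using b dc by (intro bexI[of _ b]) (auto simp: is_lifting_def)
  qed
qed

lemma tribe_Gpd: "tribe (Gpd \<kappa>) (normal_cloven_fibrations \<kappa>) (\<lambda>f g. (fp0 f g, fp1 f g))"
proof (intro tribe.intro category_Gpd tribe_axioms.intro)
  show "normal_cloven_fibrations \<kappa> \<subseteq> arr (Gpd \<kappa>)"
    by (auto simp: normal_cloven_fibrations_def)
  show "\<exists>T. terminal (Gpd \<kappa>) T"
    using Cinfinite by (rule terminal_Gpd_exists)
  show "is_pullback (Gpd \<kappa>) f g (fst (fp0 f g, fp1 f g)) (snd (fp0 f g, fp1 f g))"
    if "f \<in> arr (Gpd \<kappa>)" "g \<in> arr (Gpd \<kappa>)" "tgt (Gpd \<kappa>) f = tgt (Gpd \<kappa>) g" for f g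
    using is_pullback_fibre_product[of f g] that by simp
  show "g \<cdot>\<^bsub>Gpd \<kappa>\<^esub> f \<in> normal_cloven_fibrations \<kappa>"
    if "f \<in> normal_cloven_fibrations \<kappa>" "g \<in> normal_cloven_fibrations \<kappa>"
      "tgt (Gpd \<kappa>) f = src (Gpd \<kappa>) g" for f g
    using normal_cloven_fibrations_comp[of f \<kappa> g] that by simp
  show "p \<in> normal_cloven_fibrations \<kappa>"
    if "is_pullback (Gpd \<kappa>) f g p q" "g \<in> normal_cloven_fibrations \<kappa>" for f g p q
    using that by (rule normal_cloven_fibrations_base_change)
  show "f \<in> normal_cloven_fibrations \<kappa>" if "isomorphism (Gpd \<kappa>) f" for f
    using that by (rule isomorphism_normal_cloven_fibration)
  show "f \<in> normal_cloven_fibrations \<kappa>"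
    if "f \<in> arr (Gpd \<kappa>)" "terminal (Gpd \<kappa>) (tgt (Gpd \<kappa>) f)" for f
    using that by (intro terminal_normal_cloven_fibration) auto
qed


section \<open>Path groupoids\<close>

text \<open>An arrow \<open>a\<close> of \<open>E\<close> from \<open>h s\<close> to \<open>h s'\<close>, viewed as one from \<open>s\<close> to \<open>s'\<close>, is coded as
  \<open>pair s (pair a s')\<close>.\<close>

definition induced_groupoid :: "('u, 'u) cat \<Rightarrow> 'u set \<Rightarrow> ('u \<Rightarrow> 'u) \<Rightarrow> ('u, 'u) cat" where
  "induced_groupoid E S h =
     (let A = {c. d0 c \<in> S \<and> d1 (d1 c) \<in> S \<and> d0 (d1 c) \<in> hom E (h (d0 c)) (h (d1 (d1 c)))}
      in \<lparr>obj = S, arr = A, src = restrict d0 A, tgt = (\<lambda>c \<in> A. d1 (d1 c)),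
          ident = (\<lambda>s \<in> S. pair s (pair (ident E (h s)) s)),
          cmp = (\<lambda>b a. if a \<in> A \<and> b \<in> A \<and> restrict (\<lambda>c. d1 (d1 c)) A a = restrict d0 A b
            then pair (d0 a) (pair (d0 (d1 b) \<cdot>\<^bsub>E\<^esub> d0 (d1 a)) (d1 (d1 b))) else undefined)\<rparr>)"

lemma induced_groupoid_simps:
  "obj (induced_groupoid E S h) = S"
  "c \<in> arr (induced_groupoid E S h) \<longleftrightarrow> d0 c \<in> S \<and> d1 (d1 c) \<in> S \<and>
     d0 (d1 c) \<in> arr E \<and> src E (d0 (d1 c)) = h (d0 c) \<and> tgt E (d0 (d1 c)) = h (d1 (d1 c))"
  "c \<in> arr (induced_groupoid E S h) \<Longrightarrow> src (induced_groupoid E S h) c = d0 c"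
  "c \<in> arr (induced_groupoid E S h) \<Longrightarrow> tgt (induced_groupoid E S h) c = d1 (d1 c)"
  "s \<in> S \<Longrightarrow> ident (induced_groupoid E S h) s = pair s (pair (ident E (h s)) s)"
  "\<lbrakk>a \<in> arr (induced_groupoid E S h); b \<in> arr (induced_groupoid E S h); d1 (d1 a) = d0 b\<rbrakk> \<Longrightarrow>
     b \<cdot>\<^bsub>induced_groupoid E S h\<^esub> a = pair (d0 a) (pair (d0 (d1 b) \<cdot>\<^bsub>E\<^esub> d0 (d1 a)) (d1 (d1 b)))"
  by (auto simp: induced_groupoid_def Let_def hom_def simp del: pair_eq_iff eq_pair_iff)

lemma small_groupoid_induced:
  assumes E: "small_groupoid \<kappa> E" and S: "|S| <o \<kappa>" and h: "h \<in> S \<rightarrow> obj E"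
  shows "small_groupoid \<kappa> (induced_groupoid E S h)"
proof -
  interpret E: groupoid E using E by (rule small_groupoid_imp_groupoid)
  let ?G = "induced_groupoid E S h"
  have ident: "ident ?G s \<in> arr ?G" if "s \<in> S" for s
    using that funcset_mem[OF h that] by (simp add: induced_groupoid_simps E.category_simps)
  have cmp: "b \<cdot>\<^bsub>?G\<^esub> a \<in> arr ?G" if "a \<in> arr ?G" "b \<in> arr ?G" "d1 (d1 a) = d0 b" for a b
    using that by (simp add: induced_groupoid_simps E.category_simps)
  have cat: "category ?G"
  proof
    fix c assume c: "c \<in> arr ?G"
    then have c': "d0 c \<in> S" "d1 (d1 c) \<in> S" "d0 (d1 c) \<in> arr E" "src E (d0 (d1 c)) = h (d0 c)"
      "tgt E (d0 (d1 c)) = h (d1 (d1 c))"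
      by (simp_all add: induced_groupoid_simps)
    show "src ?G c \<in> obj ?G" "tgt ?G c \<in> obj ?G"
      using c by (simp_all add: induced_groupoid_simps)
    show "c \<cdot>\<^bsub>?G\<^esub> ident ?G (src ?G c) = c"
      using c c' ident[OF c'(1)] E.cmp_ident[OF c'(3)]
      by (simp add: induced_groupoid_simps(3-))
    show "ident ?G (tgt ?G c) \<cdot>\<^bsub>?G\<^esub> c = c"
      using c c' ident[OF c'(2)] E.ident_cmp[OF c'(3)]
      by (simp add: induced_groupoid_simps(3-))
    fix a b assume ab: "a \<in> arr ?G" "b \<in> arr ?G" "tgt ?G c = src ?G a" "tgt ?G a = src ?G b"
    then have e: "d1 (d1 c) = d0 a" "d1 (d1 a) = d0 b"
      using c by (simp_all add: induced_groupoid_simps(3,4))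
    show "(b \<cdot>\<^bsub>?G\<^esub> a) \<cdot>\<^bsub>?G\<^esub> c = b \<cdot>\<^bsub>?G\<^esub> a \<cdot>\<^bsub>?G\<^esub> c"
      using ab(1,2) e c cmp[OF c ab(1) e(1)] cmp[OF ab(1,2) e(2)]
      by (simp add: induced_groupoid_simps E.category_simps)
  next
    fix a b assume ab: "a \<in> arr ?G" "b \<in> arr ?G" "tgt ?G a = src ?G b"
    then have e: "d1 (d1 a) = d0 b"
      by (simp_all add: induced_groupoid_simps(3,4))
    show "b \<cdot>\<^bsub>?G\<^esub> a \<in> arr ?G"
      by (rule cmp[OF ab(1,2) e])
    then show "src ?G (b \<cdot>\<^bsub>?G\<^esub> a) = src ?G a" "tgt ?G (b \<cdot>\<^bsub>?G\<^esub> a) = tgt ?G b"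
      using ab(1,2) e by (simp_all add: induced_groupoid_simps(3-))
  next
    fix s assume "s \<in> obj ?G"
    then have s: "s \<in> S" by (simp add: induced_groupoid_simps)
    show "ident ?G s \<in> arr ?G"
      by (rule ident[OF s])
    then show "src ?G (ident ?G s) = s" "tgt ?G (ident ?G s) = s"
      using s by (simp_all add: induced_groupoid_simps(3-))
  qed
  show ?thesis
  proof (rule small_groupoidI[OF cat])
    show "|obj ?G| <o \<kappa>"
      using S by (simp add: induced_groupoid_simps)
    show "|arr ?G| <o \<kappa>"
    proof (rule card_of_coded_pairs[OF _ S])
      show "arr ?G \<subseteq> {c. d0 c \<in> S \<and> d1 c \<in> {w. d0 w \<in> arr E \<and> d1 w \<in> S}}"
        by (auto simp: induced_groupoid_simps)
      show "|{w. d0 w \<in> arr E \<and> d1 w \<in> S}| <o \<kappa>"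
        using E S by (intro card_of_coded_pairs[OF order_refl]) (auto simp: small_groupoid_def)
    qed
    fix c assume c: "c \<in> arr ?G"
    let ?b = "pair (d1 (d1 c)) (pair (inverse_arrow E (d0 (d1 c))) (d0 c))"
    have b: "?b \<in> arr ?G"
      using c by (simp add: induced_groupoid_simps E.inverse_arrow)
    then show "\<exists>b \<in> arr ?G. src ?G b = tgt ?G c \<and> tgt ?G b = src ?G c \<and>
        b \<cdot>\<^bsub>?G\<^esub> c = ident ?G (src ?G c) \<and> c \<cdot>\<^bsub>?G\<^esub> b = ident ?G (tgt ?G c)"
      using c by (intro bexI[OF _ b]) (simp add: induced_groupoid_simps E.inverse_arrow)
  qed (auto simp: induced_groupoid_def Let_def extensional_def)
qed

definition vertical :: "('u, 'u) ftor \<Rightarrow> 'u set" where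
  "vertical p = {c \<in> arr (fdom p). far p c = ident (fcod p) (fob p (src (fdom p) c))}"

text \<open>A commutative square from \<open>c\<close> to \<open>c'\<close> is determined by its side \<open>a\<close> between the sources,
  as the other side is \<open>c' \<cdot> a \<cdot> c\<^sup>-\<^sup>1\<close>, and \<open>a\<close> is arbitrary.\<close>

definition path_groupoid :: "('u, 'u) ftor \<Rightarrow> ('u, 'u) cat" where
  "path_groupoid p = induced_groupoid (fdom p) (vertical p) (src (fdom p))"

definition path_refl :: "('u, 'u) ftor \<Rightarrow> ('u, 'u) ftor" where
  "path_refl p = \<lparr>fdom = fdom p, fcod = path_groupoid p,
     fob = restrict (ident (fdom p)) (obj (fdom p)),
     far = (\<lambda>a \<in> arr (fdom p). pair (ident (fdom p) (src (fdom p) a)) (pair a (ident (fdom p)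
       (tgt (fdom p) a))))\<rparr>"

definition path_bd0 :: "('u, 'u) ftor \<Rightarrow> ('u, 'u) ftor" where
  "path_bd0 p = \<lparr>fdom = path_groupoid p, fcod = fdom p, fob = restrict (src (fdom p)) (vertical p),
     far = (\<lambda>c \<in> arr (path_groupoid p). d0 (d1 c))\<rparr>"

definition path_bd1 :: "('u, 'u) ftor \<Rightarrow> ('u, 'u) ftor" where
  "path_bd1 p = \<lparr>fdom = path_groupoid p, fcod = fdom p, fob = restrict (tgt (fdom p)) (vertical p),
     far = (\<lambda>c \<in> arr (path_groupoid p).
       d1 (d1 c) \<cdot>\<^bsub>fdom p\<^esub> d0 (d1 c) \<cdot>\<^bsub>fdom p\<^esub> inverse_arrow (fdom p) (d0 c))\<rparr>"

definition path_bd :: "('u, 'u) ftor \<Rightarrow> ('u, 'u) ftor" where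
  "path_bd p = fp_pair p p (path_bd0 p) (path_bd1 p)"

lemma path_functor_simps [simp]:
  "fdom (path_refl p) = fdom p" "fcod (path_refl p) = path_groupoid p"
  "fdom (path_bd0 p) = path_groupoid p" "fcod (path_bd0 p) = fdom p"
  "fdom (path_bd1 p) = path_groupoid p" "fcod (path_bd1 p) = fdom p"
  "fdom (path_bd p) = path_groupoid p" "fcod (path_bd p) = fibre_product p p"
  "fdom (fp0 f g) = fibre_product f g" "fcod (fp0 f g) = fdom f"
  "fdom (fp1 f g) = fibre_product f g" "fcod (fp1 f g) = fdom g"
  by (simp_all add: path_refl_def path_bd0_def path_bd1_def path_bd_def fp_pair_def fp0_def fp1_def)

section \<open>The path object of a fibration\<close>

context
  fixes p :: "('u, 'u) ftor"
  assumes p: "p \<in> normal_cloven_fibrations \<kappa>"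
begin

interpretation p: is_functor p using p by (simp add: normal_cloven_fibrations_iff)
interpretation E: groupoid "fdom p"
  using p by (auto simp: normal_cloven_fibrations_iff intro: small_groupoid_imp_groupoid)
interpretation Y: groupoid "fcod p"
  using p by (auto simp: normal_cloven_fibrations_iff intro: small_groupoid_imp_groupoid)

lemma small_groupoid_path_groupoid: "small_groupoid \<kappa> (path_groupoid p)"
  unfolding path_groupoid_def
proof (rule small_groupoid_induced)
  show E: "small_groupoid \<kappa> (fdom p)"
    using p by (simp add: normal_cloven_fibrations_iff)
  have "|vertical p| \<le>o |arr (fdom p)|"
    by (rule card_of_mono1) (auto simp: vertical_def)
  then show "|vertical p| <o \<kappa>"
    using E ordLeq_ordLess_trans by (auto simp: small_groupoid_def)
qed (auto simp: vertical_def E.category_simps)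

interpretation P: groupoid "path_groupoid p"
  using small_groupoid_path_groupoid by (rule small_groupoid_imp_groupoid)

lemmas path_simps = induced_groupoid_simps[where E = "fdom p" and S = "vertical p"
  and h = "src (fdom p)", folded path_groupoid_def]

lemma vertical_arr: "c \<in> vertical p \<Longrightarrow> c \<in> arr (fdom p)"
  by (simp add: vertical_def)

lemma vertical_far:
  assumes "c \<in> vertical p"
  shows "far p c = ident (fcod p) (fob p (src (fdom p) c))"
    "fob p (tgt (fdom p) c) = fob p (src (fdom p) c)"
proof -
  show 1: "far p c = ident (fcod p) (fob p (src (fdom p) c))"
    using assms by (simp add: vertical_def)
  show "fob p (tgt (fdom p) c) = fob p (src (fdom p) c)"
    using p.far_tgt[of c] vertical_arr[OF assms]
    by (simp add: 1 Y.category_simps E.category_simps p.fob_in)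
qed

lemma ident_vertical: "e \<in> obj (fdom p) \<Longrightarrow> ident (fdom p) e \<in> vertical p"
  by (simp add: vertical_def p.far_ident E.category_simps)

lemma is_functor_path_refl: "is_functor (path_refl p)"
proof (rule is_functorI)
  fix a assume "a \<in> arr (fdom (path_refl p))"
  then have a: "a \<in> arr (fdom p)" by simp
  then have r: "far (path_refl p) a \<in> arr (path_groupoid p)"
    by (simp add: path_refl_def path_simps ident_vertical E.category_simps)
  with a show "far (path_refl p) a \<in> hom (fcod (path_refl p)) (fob (path_refl p) (src (fdom (path_refl p)) a))
        (fob (path_refl p) (tgt (fdom (path_refl p)) a))"
    by (simp add: hom_def path_simps(3,4)) (simp add: path_refl_def E.category_simps)
  fix b assume "b \<in> arr (fdom (path_refl p))"
    "tgt (fdom (path_refl p)) a = src (fdom (path_refl p)) b"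
  then have b: "b \<in> arr (fdom p)" "tgt (fdom p) a = src (fdom p) b" by simp_all
  then have r': "far (path_refl p) b \<in> arr (path_groupoid p)"
    by (simp add: path_refl_def path_simps ident_vertical E.category_simps)
  have "d1 (d1 (far (path_refl p) a)) = d0 (far (path_refl p) b)"
    using a b by (simp add: path_refl_def)
  then have "far (path_refl p) b \<cdot>\<^bsub>path_groupoid p\<^esub> far (path_refl p) a =
      pair (d0 (far (path_refl p) a))
        (pair (d0 (d1 (far (path_refl p) b)) \<cdot>\<^bsub>fdom p\<^esub> d0 (d1 (far (path_refl p) a)))
        (d1 (d1 (far (path_refl p) b))))"
    by (rule path_simps(6)[OF r r'])
  then show "far (path_refl p) (b \<cdot>\<^bsub>fdom (path_refl p)\<^esub> a) =
      far (path_refl p) b \<cdot>\<^bsub>fcod (path_refl p)\<^esub> far (path_refl p) a"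
    using a b by (simp add: path_refl_def E.category_simps del: pair_eq_iff eq_pair_iff)
next
  fix e assume "e \<in> obj (fdom (path_refl p))"
  then show "far (path_refl p) (ident (fdom (path_refl p)) e) =
    ident (fcod (path_refl p)) (fob (path_refl p) e)"
    using ident_vertical[of e]
      by (simp add: path_refl_def path_simps(5) E.category_simps del: pair_eq_iff eq_pair_iff)
qed (auto simp: path_refl_def E.category_axioms P.category_axioms path_simps(1) ident_vertical)

lemma is_functor_path_bd0: "is_functor (path_bd0 p)"
proof (rule is_functorI)
  fix c assume "c \<in> arr (fdom (path_bd0 p))"
  then have c: "c \<in> arr (path_groupoid p)" by simp
  then show "far (path_bd0 p) c \<in> hom (fcod (path_bd0 p)) (fob (path_bd0 p) (src (fdom (path_bd0 p)) c))
        (fob (path_bd0 p) (tgt (fdom (path_bd0 p)) c))"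
    by (simp add: path_bd0_def path_simps(3,4)) (simp add: path_simps hom_def)
  fix b assume "b \<in> arr (fdom (path_bd0 p))" "tgt (fdom (path_bd0 p)) c = src (fdom (path_bd0 p)) b"
  then have b: "b \<in> arr (path_groupoid p)"
    "tgt (path_groupoid p) c = src (path_groupoid p) b" by simp_all
  then have "b \<cdot>\<^bsub>path_groupoid p\<^esub> c \<in> arr (path_groupoid p)" "d1 (d1 c) = d0 b"
    using c by (simp_all add: P.category_simps path_simps(3,4))
  then show "far (path_bd0 p) (b \<cdot>\<^bsub>fdom (path_bd0 p)\<^esub> c) =
      far (path_bd0 p) b \<cdot>\<^bsub>fcod (path_bd0 p)\<^esub> far (path_bd0 p) c"
    using b(1) c by (simp add: path_bd0_def path_simps(6))
next
  fix c assume "c \<in> obj (fdom (path_bd0 p))"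
  then have c: "c \<in> vertical p" by (simp add: path_simps)
  then have "ident (path_groupoid p) c \<in> arr (path_groupoid p)"
    by (simp add: P.category_simps path_simps(1))
  then show "far (path_bd0 p) (ident (fdom (path_bd0 p)) c) =
    ident (fcod (path_bd0 p)) (fob (path_bd0 p) c)"
    using c by (simp add: path_bd0_def path_simps(5))
qed (auto
  simp: path_bd0_def E.category_axioms P.category_axioms path_simps(1) E.category_simps
    vertical_arr)

text \<open>The arrow part is the side of a square between the targets. Pasting two squares cancels
  their common vertical side against its inverse.\<close>

lemma is_functor_path_bd1: "is_functor (path_bd1 p)"
proof (rule is_functorI)
  fix c assume "c \<in> arr (fdom (path_bd1 p))"
  then have c: "c \<in> arr (path_groupoid p)" by simp
  then show "far (path_bd1 p) c \<in> hom (fcod (path_bd1 p)) (fob (path_bd1 p) (src (fdom (path_bd1 p)) c))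
        (fob (path_bd1 p) (tgt (fdom (path_bd1 p)) c))"
    by (simp add: path_bd1_def path_simps(3,4))
      (simp add: path_simps hom_def vertical_arr E.inverse_arrow E.category_simps)
  fix b assume "b \<in> arr (fdom (path_bd1 p))" "tgt (fdom (path_bd1 p)) c = src (fdom (path_bd1 p)) b"
  then have b: "b \<in> arr (path_groupoid p)"
    "tgt (path_groupoid p) c = src (path_groupoid p) b" by simp_all
  then have bc: "b \<cdot>\<^bsub>path_groupoid p\<^esub> c \<in> arr (path_groupoid p)" "d1 (d1 c) = d0 b"
    using c by (simp_all add: P.category_simps path_simps(3,4))
  then have "far (path_bd1 p) (b \<cdot>\<^bsub>path_groupoid p\<^esub> c) =
      d1 (d1 b) \<cdot>\<^bsub>fdom p\<^esub> (d0 (d1 b) \<cdot>\<^bsub>fdom p\<^esub> d0 (d1 c)) \<cdot>\<^bsub>fdom p\<^esub> inverse_arrow (fdom p) (d0 c)"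
    using b(1) c by (simp add: path_bd1_def path_simps(6))
  then show "far (path_bd1 p) (b \<cdot>\<^bsub>fdom (path_bd1 p)\<^esub> c) =
      far (path_bd1 p) b \<cdot>\<^bsub>fcod (path_bd1 p)\<^esub> far (path_bd1 p) c"
    using b(1) c bc(2)
    by (simp add: path_bd1_def)
      (simp add: path_simps vertical_arr E.inverse_arrow E.category_simps
        E.inverse_arrow_cmp_cancel)
next
  fix c assume "c \<in> obj (fdom (path_bd1 p))"
  then have c: "c \<in> vertical p" by (simp add: path_simps)
  then have "ident (path_groupoid p) c \<in> arr (path_groupoid p)"
    by (simp add: P.category_simps path_simps(1))
  then show "far (path_bd1 p) (ident (fdom (path_bd1 p)) c) =
    ident (fcod (path_bd1 p)) (fob (path_bd1 p) c)"
    using c vertical_arr[OF c] E.ident_cmp[of "inverse_arrow (fdom p) c"]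
    by (simp add: path_bd1_def path_simps(5) E.inverse_arrow)
qed (auto
  simp: path_bd1_def E.category_axioms P.category_axioms path_simps(1) E.category_simps
    vertical_arr)

text \<open>Vertical arrows and their inverses are sent to identities by \<open>p\<close>, so the
  two remaining sides of a square have the same image.\<close>

lemma comp_path_bd: "comp_functor p (path_bd0 p) = comp_functor p (path_bd1 p)"
proof (rule functor_eqI)
  fix c assume "c \<in> arr (fdom (comp_functor p (path_bd0 p)))"
  then have c: "c \<in> arr (path_groupoid p)" by simp
  then have v: "d0 c \<in> vertical p" "d1 (d1 c) \<in> vertical p" "d0 (d1 c) \<in> arr (fdom p)"
    "src (fdom p) (d0 (d1 c)) = src (fdom p) (d0 c)"
      "tgt (fdom p) (d0 (d1 c)) = src (fdom p) (d1 (d1 c))"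
    by (simp_all add: path_simps)
  have inv: "far p (inverse_arrow (fdom p) (d0 c)) = ident (fcod p) (fob p (src (fdom p) (d0 c)))"
    using p.far_inverse_arrow[OF E.groupoid_axioms Y.groupoid_axioms vertical_arr[OF v(1)]] v
    by (simp add: vertical_far(1) Y.inverse_arrow_ident p.fob_in E.category_simps vertical_arr)
  have "far p (d1 (d1 c) \<cdot>\<^bsub>fdom p\<^esub> d0 (d1 c) \<cdot>\<^bsub>fdom p\<^esub> inverse_arrow (fdom p) (d0 c)) =
      ident (fcod p) (tgt (fcod p) (far p (d0 (d1 c)))) \<cdot>\<^bsub>fcod p\<^esub>
      far p (d0 (d1 c)) \<cdot>\<^bsub>fcod p\<^esub> ident (fcod p) (src (fcod p) (far p (d0 (d1 c))))"
    using v by (simp add: p.far_cmp inv vertical_far(1) vertical_arr E.category_simps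
      E.inverse_arrow p.far_src p.far_tgt)
  also have "\<dots> = far p (d0 (d1 c))"
    using v by (simp only: Y.cmp_ident Y.ident_cmp p.far_in)
  finally show "far (comp_functor p (path_bd0 p)) c = far (comp_functor p (path_bd1 p)) c"
    using c by (simp add: path_bd0_def path_bd1_def)
qed (auto intro!: is_functor_comp is_functor_path_bd0 is_functor_path_bd1 p.is_functor_axioms)

lemma path_bd_projections:
  "is_functor (path_bd p)"
  "comp_functor (fp0 p p) (path_bd p) = path_bd0 p"
  "comp_functor (fp1 p p) (path_bd p) = path_bd1 p"
proof -
  have pp: "p \<in> arr (Gpd \<kappa>)" using p by (simp add: normal_cloven_fibrations_iff)
  show bd: "is_functor (path_bd p)"
    unfolding path_bd_def
    by (rule is_functor_fp_pair[OF pp pp refl])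
      (simp_all add: is_functor_path_bd0 is_functor_path_bd1 comp_path_bd)
  show "comp_functor (fp0 p p) (path_bd p) = path_bd0 p"
  proof (rule functor_eqI)
    fix c assume c: "c \<in> arr (fdom (comp_functor (fp0 p p) (path_bd p)))"
    then have "far (path_bd p) c \<in> arr (fibre_product p p)"
      using is_functor.far_in[OF bd, of c] by simp
    then show "far (comp_functor (fp0 p p) (path_bd p)) c = far (path_bd0 p) c"
      using c by simp (simp add: fp0_def path_bd_def fp_pair_def)
  qed (auto intro!: is_functor_comp bd is_functor_fp0 pp is_functor_path_bd0)
  show "comp_functor (fp1 p p) (path_bd p) = path_bd1 p"
  proof (rule functor_eqI)
    fix c assume c: "c \<in> arr (fdom (comp_functor (fp1 p p) (path_bd p)))"
    then have "far (path_bd p) c \<in> arr (fibre_product p p)"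
      using is_functor.far_in[OF bd, of c] by simp
    then show "far (comp_functor (fp1 p p) (path_bd p)) c = far (path_bd1 p) c"
      using c by simp (simp add: fp1_def path_bd_def fp_pair_def)
  qed (auto intro!: is_functor_comp bd is_functor_fp1 pp is_functor_path_bd1)
qed

text \<open>Given a vertical arrow and arrows out of its two ends, the square is completed by
  conjugation. The new side is again vertical because the two given arrows have the same image under
  \<open>p\<close>.\<close>

lemma path_bd_class: "path_bd p \<in> normal_cloven_fibrations \<kappa>"
proof -
  have "\<exists>b. is_lifting (path_bd p) c a b"
    if c: "c \<in> vertical p" and a: "a \<in> arr (fibre_product p p)"
      and src: "src (fibre_product p p) a = fob (path_bd p) c" for c a
  proof -
    have a': "d0 a \<in> arr (fdom p)" "d1 a \<in> arr (fdom p)" "far p (d0 a) = far p (d1 a)"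
      "src (fdom p) (d0 a) = src (fdom p) c" "src (fdom p) (d1 a) = tgt (fdom p) c"
      using a c src
        by (simp_all add: fibre_product_simps path_bd_def fp_pair_def path_bd0_def path_bd1_def
          path_simps(1))
    note ca = vertical_arr[OF c]
    let ?c' = "d1 a \<cdot>\<^bsub>fdom p\<^esub> c \<cdot>\<^bsub>fdom p\<^esub> inverse_arrow (fdom p) (d0 a)"
    have "far p ?c' =
      far p (d1 a) \<cdot>\<^bsub>fcod p\<^esub> ident (fcod p)
        (fob p (src (fdom p) c)) \<cdot>\<^bsub>fcod p\<^esub> inverse_arrow (fcod p) (far p (d0 a))"
      using a' ca p.far_inverse_arrow[OF E.groupoid_axioms Y.groupoid_axioms a'(1)]
      by (simp add: p.far_cmp E.inverse_arrow E.category_simps vertical_far(1)[OF c])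
    also have "\<dots> = far p (d0 a) \<cdot>\<^bsub>fcod p\<^esub> inverse_arrow (fcod p) (far p (d0 a))"
      using a' Y.ident_cmp[of "inverse_arrow (fcod p) (far p (d0 a))"] p.far_src[OF a'(1)]
      by (simp add: Y.inverse_arrow p.far_in)
    also have "\<dots> = ident (fcod p) (fob p (tgt (fdom p) (d0 a)))"
      using a' p.far_tgt[OF a'(1)] by (simp add: Y.inverse_arrow p.far_in)
    finally have c': "?c' \<in> vertical p"
      using a' ca by (simp add: vertical_def E.inverse_arrow E.category_simps)
    let ?b = "pair c (pair (d0 a) ?c')"
    have b: "?b \<in> arr (path_groupoid p)"
      using a' ca c c' by (simp add: path_simps E.inverse_arrow E.category_simps)
    have "?c' \<cdot>\<^bsub>fdom p\<^esub> d0 a \<cdot>\<^bsub>fdom p\<^esub> inverse_arrow (fdom p) c = d1 a"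
      using a' ca E.cmp_ident[OF a'(2)]
        by (simp add: E.inverse_arrow E.category_simps E.inverse_arrow_cmp_cancel)
    then have "is_lifting (path_bd p) c a ?b"
      using b by (simp add: is_lifting_def path_simps(3))
        (simp add: path_bd_def fp_pair_def path_bd0_def path_bd1_def)
    then show ?thesis ..
  qed
  then have "Grothendieck_fibration (path_bd p)"
    using path_bd_projections(1) by (simp add: Grothendieck_fibration_def path_simps(1))
  then show ?thesis
    using p path_bd_projections(1) small_groupoid_path_groupoid small_groupoid_fibre_product[of p p]
    by (simp add: normal_cloven_fibrations_iff)
qed

lemma path_bd_refl:
  "comp_functor (path_bd0 p) (path_refl p) = id_functor (fdom p)"
  "comp_functor (path_bd1 p) (path_refl p) = id_functor (fdom p)"
proof -
  have r: "far (path_refl p) a \<in> arr (path_groupoid p)" if "a \<in> arr (fdom p)" for a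
    using is_functor.far_in[OF is_functor_path_refl, of a] that by simp
  show "comp_functor (path_bd0 p) (path_refl p) = id_functor (fdom p)"
  proof (rule functor_eqI)
    fix a assume "a \<in> arr (fdom (comp_functor (path_bd0 p) (path_refl p)))"
    then show "far (comp_functor (path_bd0 p) (path_refl p)) a = far (id_functor (fdom p)) a"
      using r[of a] by simp (simp add: path_bd0_def path_refl_def)
  qed (auto intro!: is_functor_comp is_functor_path_refl is_functor_path_bd0 is_functor_id
    E.category_axioms)
  show "comp_functor (path_bd1 p) (path_refl p) = id_functor (fdom p)"
  proof (rule functor_eqI)
    fix a assume "a \<in> arr (fdom (comp_functor (path_bd1 p) (path_refl p)))"
    then show "far (comp_functor (path_bd1 p) (path_refl p)) a = far (id_functor (fdom p)) a"
      using r[of a] E.cmp_ident[of a] E.ident_cmp[of a]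
      by simp (simp add: path_bd1_def path_refl_def E.inverse_arrow_ident E.category_simps)
  qed (auto intro!: is_functor_comp is_functor_path_refl is_functor_path_bd1 is_functor_id
    E.category_axioms)
qed

text \<open>The witness is the square with identity side from \<open>c\<close> to the constant path
  at its start. Its image under \<open>path_bd0\<close> being an identity allows the contraction to
  be carried out inside a mapping path groupoid as well.\<close>

lemma path_contraction:
  assumes c: "c \<in> vertical p"
  shows "\<exists>b \<in> arr (path_groupoid p). src (path_groupoid p) b = c \<and>
    tgt (path_groupoid p) b = fob (path_refl p) (src (fdom p) c) \<and>
    far (path_bd0 p) b = ident (fdom p) (src (fdom p) c)"
proof -
  let ?e = "src (fdom p) c"
  let ?b = "pair c (pair (ident (fdom p) ?e) (ident (fdom p) ?e))"
  have e: "?e \<in> obj (fdom p)"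
    using vertical_arr[OF c] by (simp add: E.category_simps)
  then have b: "?b \<in> arr (path_groupoid p)"
    using c by (simp add: path_simps ident_vertical E.category_simps)
  then show ?thesis
    using e by (intro bexI[OF _ b])
      (simp add: path_simps(3,4), simp add: path_refl_def path_bd0_def)
qed

text \<open>Between constant paths both outer components of the code are identities, determined by
  the ends of the middle one, which is what \<open>path_bd0\<close> extracts.\<close>

lemma path_refl_full:
  assumes "a \<in> arr (path_groupoid p)" "src (path_groupoid p) a \<in> fob (path_refl p) ` obj (fdom p)"
    "tgt (path_groupoid p) a \<in> fob (path_refl p) ` obj (fdom p)"
  shows "far (path_bd0 p) a \<in> arr (fdom p)" "a = far (path_refl p) (far (path_bd0 p) a)"
proof -
  obtain x y where xy: "x \<in> obj (fdom p)" "y \<in> obj (fdom p)" "d0 a = ident (fdom p) x"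
    "d1 (d1 a) = ident (fdom p) y"
    using assms by (auto simp: path_simps(3,4) path_refl_def)
  have a: "d0 (d1 a) \<in> arr (fdom p)" "src (fdom p) (d0 (d1 a)) = x" "tgt (fdom p) (d0 (d1 a)) = y"
    using assms(1) xy by (simp_all add: path_simps E.category_simps)
  then show "far (path_bd0 p) a \<in> arr (fdom p)"
    using assms(1) by (simp add: path_bd0_def)
  have "a = pair (d0 a) (pair (d0 (d1 a)) (d1 (d1 a)))"
    by simp
  then show "a = far (path_refl p) (far (path_bd0 p) a)"
    using assms(1) a xy by (simp add: path_bd0_def path_refl_def)
qed

lemma injective_equivalence_path_refl: "injective_equivalence (path_refl p)"
  unfolding injective_equivalence_def
proof (intro conjI ballI impI)
  show "inj_on (far (path_refl p)) (arr (fdom (path_refl p)))"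
    by (rule inj_onI) (simp add: path_refl_def)
  show "a \<in> far (path_refl p) ` arr (fdom (path_refl p))"
    if "a \<in> arr (fcod (path_refl p))"
      "src (fcod (path_refl p)) a \<in> fob (path_refl p) ` obj (fdom (path_refl p)) \<and>
      tgt (fcod (path_refl p)) a \<in> fob (path_refl p) ` obj (fdom (path_refl p))" for a
    using path_refl_full[of a] that by auto
  show "\<exists>a \<in> arr (fcod (path_refl p)). src (fcod (path_refl p)) a = c \<and>
      tgt (fcod (path_refl p)) a \<in> fob (path_refl p) ` obj (fdom (path_refl p))"
    if "c \<in> obj (fcod (path_refl p))" for c
    using path_contraction[of c] that by (auto simp: path_simps(1) vertical_arr E.category_simps)
qed

text \<open>Here \<open>g\<close> is any functor, hence \<open>m1\<close> need not be an
  isofibration and \<open>injective_equivalence_base_change\<close> does not apply. Instead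
  \<open>m0\<close> is a retraction of \<open>j\<close>, and contracting the path component while
  fixing the base component joins every object to the image.\<close>

lemma injective_equivalence_mapping_path:
  assumes pb: "is_pullback (Gpd \<kappa>) g (path_bd0 p) m0 m1"
    and j: "j \<in> hom (Gpd \<kappa>) (fdom g) (fdom m0)" "comp_functor m0 j = id_functor (fdom g)"
      "comp_functor m1 j = comp_functor (path_refl p) g"
  shows "injective_equivalence j"
proof -
  have dc: "fdom j = fdom g" "fcod j = fdom m0" "fdom m1 = fdom m0" "fcod g = fdom p"
    "fcod m0 = fdom g" "fcod m1 = path_groupoid p"
    and F: "is_functor g" "is_functor m0" "is_functor m1" "is_functor j"
    using pb j by (auto simp: is_pullback_def hom_Gpd)
  interpret g: is_functor g by fact
  interpret m0: is_functor m0 by fact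
  interpret m1: is_functor m1 by fact
  interpret j: is_functor j by fact
  interpret X: category "fdom g" by (rule g.fdom_category)
  interpret M: category "fdom m0" by (rule m0.fdom_category)
  have m_ob: "fob m0 (fob j x) = x" "fob m1 (fob j x) = fob (path_refl p) (fob g x)"
    if "x \<in> obj (fdom g)" for x
    using arg_cong[OF j(2), of "\<lambda>F. fob F x"] arg_cong[OF j(3), of "\<lambda>F. fob F x"] that
      by (simp_all add: dc)
  have m_ar: "far m0 (far j x) = x" "far m1 (far j x) = far (path_refl p) (far g x)"
    if "x \<in> arr (fdom g)" for x
    using arg_cong[OF j(2), of "\<lambda>F. far F x"] arg_cong[OF j(3), of "\<lambda>F. far F x"] that
      by (simp_all add: dc)
  have ob_eqI: "z = w"
    if "z \<in> obj (fdom m0)" "w \<in> obj (fdom m0)" "fob m0 z = fob m0 w" "fob m1 z = fob m1 w" for z w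
    using inj_onD[OF bij_betw_imp_inj_on[OF is_pullback_strict(1)[OF pb]], of z w] that by simp
  have ar_eqI: "a = b"
    if "a \<in> arr (fdom m0)" "b \<in> arr (fdom m0)" "far m0 a = far m0 b" "far m1 a = far m1 b" for a b
    using inj_onD[OF bij_betw_imp_inj_on[OF is_pullback_strict(2)[OF pb]], of a b] that by simp
  have eq: "far g (far m0 b) = far (path_bd0 p) (far m1 b)" if "b \<in> arr (fdom m0)" for b
    using bij_betwE[OF is_pullback_strict(2)[OF pb]] that by auto
  show ?thesis
    unfolding injective_equivalence_def dc
  proof (intro conjI ballI impI)
    show "inj_on (far j) (arr (fdom g))"
      by (rule inj_on_inverseI) (rule m_ar(1))
  next
    fix a assume a: "a \<in> arr (fdom m0)"
      and "src (fdom m0) a \<in> fob j ` obj (fdom g) \<and> tgt (fdom m0) a \<in> fob j ` obj (fdom g)"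
    then obtain x y where xy: "x \<in> obj (fdom g)" "y \<in> obj (fdom g)" "src (fdom m0) a = fob j x"
      "tgt (fdom m0) a = fob j y"
      by auto
    have m1a: "far m1 a \<in> arr (path_groupoid p)"
      "src (path_groupoid p) (far m1 a) = fob (path_refl p) (fob g x)"
      "tgt (path_groupoid p) (far m1 a) = fob (path_refl p) (fob g y)"
      using m1.far_in[of a] m1.far_src[of a] m1.far_tgt[of a] a xy by (simp_all add: dc m_ob)
    have m0a: "far m0 a \<in> arr (fdom g)"
      using m0.far_in[of a] a by (simp add: dc)
    have gx: "fob g x \<in> obj (fdom p)" "fob g y \<in> obj (fdom p)"
      using g.fob_in xy dc by auto
    \<comment> \<open>An arrow between constant paths is a reflexivity, so the path component of
      \<open>a\<close> is determined by its base component.\<close>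
    have "far m1 a = far (path_refl p) (far (path_bd0 p) (far m1 a))"
      by (rule path_refl_full(2)) (use m1a gx in simp_all)
    then have m1_eq: "far m1 a = far (path_refl p) (far g (far m0 a))"
      by (simp add: eq[OF a])
    have "a = far j (far m0 a)"
      by (rule ar_eqI) (use a m0a m1_eq j.far_in[of "far m0 a"] in \<open>simp_all add: m_ar dc\<close>)
    then show "a \<in> far j ` arr (fdom g)"
      using m0a by blast
  next
    fix z assume z: "z \<in> obj (fdom m0)"
    let ?w = "fob m0 z" and ?c = "fob m1 z"
    have w: "?w \<in> obj (fdom g)" and c: "?c \<in> vertical p"
      using m0.fob_in[OF z] m1.fob_in[of z] z by (simp_all add: dc path_simps(1))
    have gw: "fob g ?w = src (fdom p) ?c"
      using is_pullback_ob_eq[OF pb z] c by (simp add: path_bd0_def)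
    obtain b where b: "b \<in> arr (path_groupoid p)" "src (path_groupoid p) b = ?c"
      "tgt (path_groupoid p) b = fob (path_refl p) (fob g ?w)"
        "far (path_bd0 p) b = ident (fdom p) (fob g ?w)"
      using path_contraction[OF c] gw by auto
    \<comment> \<open>The pair is an arrow of the pullback because the contraction \<open>b\<close>
      has an identity as its image under \<open>path_bd0\<close>.\<close>
    have "(ident (fdom g) ?w, b) \<in> (\<lambda>a. (far m0 a, far m1 a)) ` arr (fdom m0)"
      using bij_betw_imp_surj_on[OF is_pullback_strict(2)[OF pb]] b w
      by (simp add: X.category_simps g.far_ident dc)
    then obtain a where a: "a \<in> arr (fdom m0)" "far m0 a = ident (fdom g) ?w" "far m1 a = b"
      by auto
    have "src (fdom m0) a = z"
      by (rule ob_eqI)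
        (use a b z w m0.far_src[of a] m1.far_src[of a] in
          \<open>simp_all add: M.category_simps X.category_simps dc\<close>)
    moreover have "tgt (fdom m0) a = fob j ?w"
      by (rule ob_eqI)
        (use a b z w m0.far_tgt[of a] m1.far_tgt[of a] j.fob_in[of ?w] in
          \<open>simp_all add: M.category_simps X.category_simps dc m_ob\<close>)
    ultimately show "\<exists>a \<in> arr (fdom m0). src (fdom m0) a = z \<and>
      tgt (fdom m0) a \<in> fob j ` obj (fdom g)"
      using a(1) w by auto
  qed
qed

end

section \<open>Assembly of the tribe and its stable path objects\<close>

lemma tribe_with_path_objects_Gpd:
  "tribe_with_path_objects (Gpd \<kappa>) (normal_cloven_fibrations \<kappa>) (\<lambda>f g. (fp0 f g, fp1 f g))
    path_refl path_bd"
proof -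
  interpret tribe "Gpd \<kappa>" "normal_cloven_fibrations \<kappa>" "\<lambda>f g. (fp0 f g, fp1 f g)"
    by (rule tribe_Gpd)
  show ?thesis
  proof
    fix p assume p: "p \<in> normal_cloven_fibrations \<kappa>"
    then have p': "p \<in> arr (Gpd \<kappa>)" using class_arr by blast
    note r = is_functor_path_refl[OF p] and bd = path_bd_projections[OF p]
      and P = small_groupoid_path_groupoid[OF p]
    show "path_refl p \<in> hom (Gpd \<kappa>) (src (Gpd \<kappa>) p) (src (Gpd \<kappa>) (path_bd p))"
      using r P p' by (simp add: hom_Gpd)
    show "path_bd p \<in> normal_cloven_fibrations \<kappa>"
      by (rule path_bd_class[OF p])
    show "tgt (Gpd \<kappa>) (path_bd p) = apex p p"
      by (simp add: apex_def pr0_def)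
    have "comp_functor (fp0 p p) (comp_functor (path_bd p) (path_refl p)) = id_functor (fdom p)"
      using category.cmp_assoc[OF category_Gpd[of \<kappa>], of "path_refl p" "path_bd p"
        "fp0 p p"] p' r bd P
        is_functor_fp0[OF p' p' refl] small_groupoid_fibre_product[OF p' p' refl] path_bd_refl[OF p]
      by simp
    moreover have "comp_functor (fp1 p p) (comp_functor (path_bd p) (path_refl p)) =
      id_functor (fdom p)"
      using category.cmp_assoc[OF category_Gpd[of \<kappa>], of "path_refl p" "path_bd p"
        "fp1 p p"] p' r bd P
        is_functor_fp1[OF p' p' refl] small_groupoid_fibre_product[OF p' p' refl] path_bd_refl[OF p]
      by simp
    moreover have "comp_functor (path_bd p) (path_refl p) \<in> hom (Gpd \<kappa>) (fdom p)
      (fibre_product p p)"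
      using r bd p' small_groupoid_fibre_product[OF p' p' refl]
        by (simp add: hom_Gpd is_functor_comp)
    ultimately have "diagonal p = comp_functor (path_bd p) (path_refl p)"
      unfolding diagonal_def using p p'
      by (intro pairing(4))
        (simp_all add: apex_def pr0_def pr1_def is_functor_id is_functor.fdom_category)
    then show "path_bd p \<cdot>\<^bsub>Gpd \<kappa>\<^esub> path_refl p = diagonal p"
      by simp
    fix q s t g
    assume "q \<in> normal_cloven_fibrations \<kappa>" and pb: "is_pullback (Gpd \<kappa>) q (path_refl p) s t"
      and g: "g \<in> normal_cloven_fibrations \<kappa>"
    then have "injective_equivalence s"
      by (intro injective_equivalence_base_change[OF pb] injective_equivalence_path_refl[OF p])
    then show "left_lifting (Gpd \<kappa>) s g"
      using pb g by (intro left_lifting_injective_equivalence) (simp_all add: is_pullback_def)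
  qed
qed

lemma tribe_with_stable_path_objects_Gpd:
  "tribe_with_stable_path_objects (Gpd \<kappa>) (normal_cloven_fibrations \<kappa>) (\<lambda>f g. (fp0 f g, fp1 f g))
    path_refl path_bd"
proof -
  interpret tribe_with_path_objects "Gpd \<kappa>" "normal_cloven_fibrations \<kappa>"
    "\<lambda>f g. (fp0 f g, fp1 f g)" path_refl path_bd
    by (rule tribe_with_path_objects_Gpd)
  show ?thesis
  proof
    fix p f fp pf
    assume p: "p \<in> normal_cloven_fibrations \<kappa>" and f: "f \<in> arr (Gpd \<kappa>)"
      and fp: "tgt (Gpd \<kappa>) f = tgt (Gpd \<kappa>) p"
      and fp_def: "fp = pr0 f p" and pf_def: "pf = pr1 f p"
    have p': "p \<in> arr (Gpd \<kappa>)" using p class_arr by blast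
    \<comment> \<open>The boundary of the abstract setting is a composite with a projection; it is
      identified with the explicit functor so that the lemma on mapping paths applies.\<close>
    have bd0: "bd0 p = path_bd0 p"
      using path_bd_projections[OF p] by (simp add: bd0_def pr0_def)
    note pr = chosen_pullback_projections[OF f p' fp disjI2[OF p], folded fp_def pf_def]
    have "is_pullback (Gpd \<kappa>) pf (path_bd0 p) (pm0 p pf) (pm1 p pf)"
      using chosen_pullback[OF pr(2), of "bd0 p"] bd0_bd1[OF p] pr class_arr
      by (auto simp: pm0_def pm1_def pr0_def pr1_def bd0)
    note pb = this
    show "\<exists>i \<in> hom (Gpd \<kappa>) (Map p pf) (Path fp).
        i \<cdot>\<^bsub>Gpd \<kappa>\<^esub> pairing pf (bd0 p) (ident (Gpd \<kappa>) (apex f p))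
          (path_refl p \<cdot>\<^bsub>Gpd \<kappa>\<^esub> pf) = path_refl fp \<and>
        path_bd fp \<cdot>\<^bsub>Gpd \<kappa>\<^esub> i =
          pairing fp fp (pm0 p pf) (pairing f p (fp \<cdot>\<^bsub>Gpd \<kappa>\<^esub> pm0 p pf) (bd1 p \<cdot>\<^bsub>Gpd \<kappa>\<^esub> pm1 p pf))"
    proof (rule stable_path_objects_of_lifting[OF p f fp fp_def pf_def])
      let ?j = "pairing pf (bd0 p) (ident (Gpd \<kappa>) (apex f p)) (path_refl p \<cdot>\<^bsub>Gpd \<kappa>\<^esub> pf)"
      assume j: "?j \<in> hom (Gpd \<kappa>) (apex f p) (Map p pf)"
        "pm0 p pf \<cdot>\<^bsub>Gpd \<kappa>\<^esub> ?j = ident (Gpd \<kappa>) (apex f p)"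
        "pm1 p pf \<cdot>\<^bsub>Gpd \<kappa>\<^esub> ?j = path_refl p \<cdot>\<^bsub>Gpd \<kappa>\<^esub> pf"
        and "fp \<in> normal_cloven_fibrations \<kappa>"
      have "injective_equivalence ?j"
        using j pr
          by (intro injective_equivalence_mapping_path[OF p pb])
            (simp_all add: Map_def pm0_def apex_def)
      then show "left_lifting (Gpd \<kappa>) ?j (path_bd fp)"
        using j(1) bd_class[OF \<open>fp \<in> normal_cloven_fibrations \<kappa>\<close>]
        by (intro left_lifting_injective_equivalence) (auto simp: hom_Gpd)
    qed
  qed
qed

end

text \<open>The field of \<kappa> is an infinite subset of \<open>'u\<close>, and an infinite type
  is equinumerous with its square. The code and its decodings come from one such bijection.\<close>

lemma pair_code_exists:
  assumes "Cinfinite (\<kappa> :: 'u rel)"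
  shows "\<exists>pair d0 d1. pair_code \<kappa> pair d0 d1"
proof -
  have "infinite (UNIV :: 'u set)"
    using assms finite_subset[OF subset_UNIV] by (auto simp: cinfinite_def)
  then have "|(UNIV :: 'u set) \<times> (UNIV :: 'u set)| =o |UNIV :: 'u set|"
    by (rule card_of_Times_same_infinite)
  then obtain c :: "'u \<times> 'u \<Rightarrow> 'u" where "bij_betw c (UNIV \<times> UNIV) UNIV"
    by (auto simp: card_of_ordIso[symmetric])
  then have c: "bij c" by simp
  have "pair_code \<kappa> (\<lambda>x y. c (x, y)) (\<lambda>z. fst (inv c z)) (\<lambda>z. snd (inv c z))"
  proof
    show "Cinfinite \<kappa>" by (rule assms)
    show "fst (inv c (c (x, y))) = x" "snd (inv c (c (x, y))) = y" for x y
      using c by (simp_all add: bij_is_inj)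
    show "c (fst (inv c z), snd (inv c z)) = z" for z
      using c by (simp add: bij_is_surj surj_f_inv_f)
  qed
  then show ?thesis by blast
qed

theorem theorem4p3:
  fixes \<kappa> :: "'u rel"
  assumes "Cinfinite \<kappa>"
  shows "\<exists>pb r bd. tribe_with_stable_path_objects (Gpd \<kappa>) (normal_cloven_fibrations \<kappa>) pb r bd"
proof -
  obtain pair d0 d1 where "pair_code \<kappa> pair d0 d1"
    using pair_code_exists[OF assms] by blast
  then show ?thesis
    using pair_code.tribe_with_stable_path_objects_Gpd by blast
qed

end
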